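(* Let $d\in\mathbb N$, $\mathcal S\subseteq\mathcal M_d$ bounded, $A\in\operatorname{conv}(\mathcal S)$ and $\epsilon>0$. Then there is a matrix $B$ with $\|A-B\|_p\le\epsilon$ which is an average $B=\frac1k\sum_{i=1}^kX_i$ of $k$ (not necessarily distinct) points $X_i\in\mathcal S$, where (a) $\displaystyle k=\Big\lceil C_p\Big(\frac{\operatorname{diam}(\mathcal S)}{\epsilon}\Big)^{\frac{p}{p-1}}\Big\rceil$ if $1<p\le4/3$; (b) $\displaystyle k=\Big\lceil D_p\Big(\frac{\operatorname{diam}(\mathcal S)}{\epsilon}\Big)^{2}\Big\rceil$ if $p=2$ or $4\le p<\infty$, with $C_p=\big(2e^2/p^{1/p}\big)^{p/(p-1)}$ and $D_p=2(p-1)e^4$. In particular $B$ is a convex combination of at most this many points of $\mathcal S$.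
   Context: $\mathcal M_d$ denotes the complex $d\times d$ matrices with the (unnormalised) Schatten $p$-norm $\|A\|_p=(\sum_i s_i(A)^p)^{1/p}$, $s_i(A)$ the singular values; $\operatorname{diam}$ is taken with respect to $\|\cdot\|_p$.
   Formalization: When diam(S)=0 the formula gives k=0 and the average of k points is undefined; the formal statement takes k to be the maximum of 1 and the stated ceiling, which agrees with the stated k whenever diam(S)>0. The closing "in particular" is left as immediate. *)

theory Defs
  imports "HOL-Analysis.Analysis" "HOL-Computational_Algebra.Polynomial"
begin

definition conj_transpose :: "complex ^ 'n ^ 'm \<Rightarrow> complex ^ 'm ^ 'n" where
  "conj_transpose A = (\<chi> i j. cnj (A $ j $ i))"

definition char_poly_hma :: "complex ^ 'n ^ 'n \<Rightarrow> complex poly" where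
  "char_poly_hma A = det (\<chi> i j. (if i = j then [:0, 1:] else 0) - [: A $ i $ j :])"

text \<open>Schatten p-norm: (sum of s_i^p)^(1/p), where the singular values s_i are the square
  roots of the eigenvalues (with algebraic multiplicity) of A^* A, so s_i^p = lambda_i^(p/2).\<close>

definition schatten_norm :: "real \<Rightarrow> complex ^ 'n ^ 'n \<Rightarrow> real" where
  "schatten_norm p A =
     (let q = char_poly_hma (conj_transpose A ** A) in
       (\<Sum>z\<in>{z. poly q z = 0}. real (order z q) * (cmod z) powr (p / 2)) powr (1 / p))"

definition schatten_bounded :: "real \<Rightarrow> (complex ^ 'n ^ 'n) set \<Rightarrow> bool" where
  "schatten_bounded p S \<longleftrightarrow> (\<exists>M. \<forall>X\<in>S. schatten_norm p X \<le> M)"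

definition schatten_diam :: "real \<Rightarrow> (complex ^ 'n ^ 'n) set \<Rightarrow> real" where
  "schatten_diam p S = (SUP XY\<in>S \<times> S. schatten_norm p (fst XY - snd XY))"

end

theory Submission
  imports Defs
begin

text \<open>
  The points are chosen greedily. Let f be a power of the norm satisfying a two-point inequality
  f (x + y) + f (x - y) \<le> 2 f x + 2 K f y. If A is the barycentre of points of S with weights w, then by
  convexity the w-average over b of f (x + b - A) is at most the average over pairs b, c of
  f (x + (b - c)); symmetrising in b, c bounds this by f x + K (diam S)^q. Hence some b in S
  increases f by at most K (diam S)^q, and k steps followed by division by k give the theorem with
  constant K.

  For p < 2 the two-point inequality holds for the p-th power with K = 1. In an eigenbasis of
  X*X + Y*Y it follows from concavity of t^(p/2), the parallelogram law, and the subadditivity of the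
  trace of t^(p/2).

  For p \<ge> 2 the square of the norm is used. The inequality at p for X, Y reduces to the one at p/2
  for the Gram matrices of X + Y and X - Y, and K doubles up to an additive 1. Repeated halving ends
  in [2, 4), where a second-order estimate of the trace of t^p on positive semidefinite
  matrices suffices. This gives K = 7 (p - 1), well below 2 (p - 1) e^4.
\<close>

section \<open>Power means and sums\<close>

text \<open>Traces of powers are compared without a functional calculus for matrices. Two
  orthonormal bases u, v enter through the squared overlaps |<u_i, v_j>|^2, which form a doubly
  stochastic matrix (substochastic for incomplete families), so that a scalar inequality and Jensen
  suffice. The obstacle for large p is that the second-order estimate speaks of powers of
  eigenvalues, while the norm is made of singular values; the two agree for positive semidefinite
  matrices. Gram matrices are of this kind, so one halving has to precede the estimate, and the
  argument beyond p = 2 starts at p = 4. The power q of the norm dictates the final exponent: k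
  steps give norm^q at most k K D^q with D the diameter, and after division by k the error is at
  most eps as soon as K (D/eps)^q <= k^(q-1). So k grows like (D/eps)^(q/(q-1)), with q = p in one
  range and q = 2 in the other.\<close>

lemma powr_tangent_le:
  fixes q x t :: real
  assumes "1 \<le> q" "0 \<le> x" "0 \<le> t"
  shows "x powr q + q * x powr (q - 1) * (t - x) \<le> t powr q"
proof (cases "q = 1 \<or> x = 0")
  case True
  then show ?thesis using assms by (cases "x = 0") auto
next
  case False
  then have q: "q > 1" and x: "x > 0" using assms by auto
  have eq: "x powr (q - 1) * x = x powr q"
    using x by (simp add: powr_diff)
  \<comment> \<open>Young's inequality for t and x^(q-1) with the conjugate exponents q and q/(q-1)
    is the tangent line inequality in disguise.\<close>
  have "t * x powr (q - 1) \<le> t powr q / q + (x powr (q - 1)) powr (q / (q - 1)) / (q / (q - 1))"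
    using q assms by (intro Youngs_inequality) (auto simp: field_simps)
  also have "(x powr (q - 1)) powr (q / (q - 1)) = x powr q"
    using q by (simp add: powr_powr)
  finally have "q * (t * x powr (q - 1)) \<le> t powr q + (q - 1) * x powr q"
    using q by (simp add: field_simps)
  then show ?thesis
    using eq by (simp add: algebra_simps)
qed

lemma powr_le_powrD: "0 < a \<Longrightarrow> 0 \<le> y \<Longrightarrow> x powr a \<le> y powr a \<Longrightarrow> x \<le> y" for a x y :: real
  by (metis powr_less_mono2 not_le)

lemma jensen_powr:
  fixes d t :: "'a \<Rightarrow> real" and q :: real
  assumes "1 \<le> q" "\<And>i. i \<in> I \<Longrightarrow> 0 \<le> d i" "\<And>i. i \<in> I \<Longrightarrow> 0 \<le> t i" "sum d I \<le> 1"
  shows "(\<Sum>i\<in>I. d i * t i) powr q \<le> (\<Sum>i\<in>I. d i * t i powr q)"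
proof -
  define x where "x = (\<Sum>i\<in>I. d i * t i)"
  have x0: "0 \<le> x" unfolding x_def using assms by (intro sum_nonneg) auto
  have eq: "x powr (q - 1) * x = x powr q"
    using x0 by (cases "x = 0") (auto simp: powr_diff)
  \<comment> \<open>The weights may sum to less than 1. Summing the tangent lines at the mean x
    produces the factor \<open>sum d I + q * (1 - sum d I)\<close>, which is at least 1 because q
    is.\<close>
  have "x powr q \<le> x powr q * (sum d I + q * (1 - sum d I))"
  proof -
    have "0 \<le> (q - 1) * (1 - sum d I)" using assms by simp
    then have "1 \<le> sum d I + q * (1 - sum d I)" by (simp add: algebra_simps)
    then show ?thesis by (metis mult_left_mono mult.right_neutral powr_ge_zero)
  qed
  also have "\<dots> = x powr q * sum d I + q * (x powr (q - 1) * x) * (1 - sum d I)"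
    by (simp only: eq) (simp add: algebra_simps)
  also have "\<dots> = sum d I * x powr q + q * x powr (q - 1) * (x - sum d I * x)"
    by (simp add: algebra_simps)
  also have "\<dots> = (\<Sum>i\<in>I. d i * (x powr q + q * x powr (q - 1) * (t i - x)))"
  proof -
    have "(\<Sum>i\<in>I. d i * (x powr q + q * x powr (q - 1) * (t i - x)))
      = (\<Sum>i\<in>I. d i * x powr q + (q * x powr (q - 1)) * (d i * t i) - d i * (q * x powr (q - 1) * x))"
      by (simp add: algebra_simps)
    also have "\<dots> = sum d I * x powr q + (q * x powr (q - 1)) * x - sum d I * (q * x powr (q - 1) * x)"
      by (simp only: sum.distrib sum_subtractf flip: sum_distrib_left sum_distrib_right x_def)
    finally show ?thesis by (simp add: algebra_simps)
  qed
  also have "\<dots> \<le> (\<Sum>i\<in>I. d i * t i powr q)"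
    using assms x0 by (intro sum_mono mult_left_mono powr_tangent_le) auto
  finally show ?thesis by (simp add: x_def)
qed

text \<open>Convex Jensen with exponent 1/r, applied to the values t^r.\<close>

lemma jensen_powr_concave:
  fixes d t :: "'a \<Rightarrow> real" and r :: real
  assumes "0 < r" "r \<le> 1" "\<And>i. i \<in> I \<Longrightarrow> 0 \<le> d i" "\<And>i. i \<in> I \<Longrightarrow> 0 \<le> t i" "sum d I \<le> 1"
  shows "(\<Sum>i\<in>I. d i * t i powr r) \<le> (\<Sum>i\<in>I. d i * t i) powr r"
proof -
  define x where "x = (\<Sum>i\<in>I. d i * t i powr r)"
  have x0: "0 \<le> x" unfolding x_def using assms by (intro sum_nonneg) auto
  have "x powr (1 / r) \<le> (\<Sum>i\<in>I. d i * (t i powr r) powr (1 / r))"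
    unfolding x_def using assms by (intro jensen_powr) auto
  also have "\<dots> = (\<Sum>i\<in>I. d i * t i)"
    using assms by (intro sum.cong) (auto simp: powr_powr)
  finally have "(x powr (1 / r)) powr r \<le> (\<Sum>i\<in>I. d i * t i) powr r"
    using assms by (intro powr_mono2) auto
  then show ?thesis using assms x0 by (simp add: powr_powr x_def)
qed

lemma powr_mean_le:
  fixes a b q :: real
  assumes "1 \<le> q" "0 \<le> a" "0 \<le> b"
  shows "((a + b) / 2) powr q \<le> (a powr q + b powr q) / 2"
  using jensen_powr[of q "{True, False}" "\<lambda>_. 1/2" "\<lambda>c. if c then a else b"] assms
  by (auto simp: add_divide_distrib)

lemma powr_mean_ge:
  fixes a b r :: real
  assumes "0 < r" "r \<le> 1" "0 \<le> a" "0 \<le> b"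
  shows "(a powr r + b powr r) / 2 \<le> ((a + b) / 2) powr r"
  using jensen_powr_concave[of r "{True, False}" "\<lambda>_. 1/2" "\<lambda>c. if c then a else b"] assms
  by (auto simp: add_divide_distrib)

text \<open>The row sums make Jensen applicable to each outer term; after exchanging the sums, the
  column sums bound the total weight that each t_j^q receives. It is applied to squared overlaps of
  Bessel families.\<close>

lemma sum_substochastic_powr_le:
  fixes D :: "'a \<Rightarrow> 'b \<Rightarrow> real" and t :: "'b \<Rightarrow> real"
  assumes "1 \<le> q" and D: "\<And>i j. i \<in> I \<Longrightarrow> j \<in> J \<Longrightarrow> 0 \<le> D i j" and t: "\<And>j. j \<in> J \<Longrightarrow> 0 \<le> t j"
    and "\<And>i. i \<in> I \<Longrightarrow> (\<Sum>j\<in>J. D i j) \<le> 1" and "\<And>j. j \<in> J \<Longrightarrow> (\<Sum>i\<in>I. D i j) \<le> 1"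
  shows "(\<Sum>i\<in>I. (\<Sum>j\<in>J. D i j * t j) powr q) \<le> (\<Sum>j\<in>J. t j powr q)"
proof -
  have "(\<Sum>i\<in>I. (\<Sum>j\<in>J. D i j * t j) powr q) \<le> (\<Sum>i\<in>I. \<Sum>j\<in>J. D i j * t j powr q)"
    using assms by (intro sum_mono jensen_powr) auto
  also have "\<dots> = (\<Sum>j\<in>J. (\<Sum>i\<in>I. D i j) * t j powr q)"
    by (subst sum.swap) (simp add: sum_distrib_right)
  also have "\<dots> \<le> (\<Sum>j\<in>J. 1 * t j powr q)"
    using assms by (intro sum_mono mult_right_mono) auto
  finally show ?thesis by simp
qed

lemma Holder_inequality_sum:
  fixes x y :: "'a \<Rightarrow> real"
  assumes "1 < a" "1 < b" "1/a + 1/b = 1" "finite I"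
    and "\<And>i. i \<in> I \<Longrightarrow> 0 \<le> x i" "\<And>i. i \<in> I \<Longrightarrow> 0 \<le> y i"
  shows "(\<Sum>i\<in>I. x i * y i) \<le> (\<Sum>i\<in>I. x i powr a) powr (1/a) * (\<Sum>i\<in>I. y i powr b) powr (1/b)"
proof -
  define X where "X = (\<Sum>i\<in>I. x i powr a) powr (1/a)"
  define Y where "Y = (\<Sum>i\<in>I. y i powr b) powr (1/b)"
  have nn: "0 \<le> (\<Sum>i\<in>I. x i powr a)" "0 \<le> (\<Sum>i\<in>I. y i powr b)"
    by (auto intro!: sum_nonneg)
  have Xa: "X powr a = (\<Sum>i\<in>I. x i powr a)" and Yb: "Y powr b = (\<Sum>i\<in>I. y i powr b)"
    using assms nn by (auto simp: X_def Y_def powr_powr)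
  show ?thesis
  proof (cases "X = 0 \<or> Y = 0")
    case True
    then have "(\<forall>i\<in>I. x i powr a = 0) \<or> (\<forall>i\<in>I. y i powr b = 0)"
      using assms(4) by (auto simp: X_def Y_def sum_nonneg_eq_0_iff)
    then have "(\<Sum>i\<in>I. x i * y i) = 0"
      by (auto intro!: sum.neutral)
    then show ?thesis by (simp flip: X_def Y_def) (simp add: X_def Y_def)
  next
    case False
    then have pos: "X > 0" "Y > 0" by (auto simp: X_def Y_def)
    have "(\<Sum>i\<in>I. x i * y i) / (X * Y) = (\<Sum>i\<in>I. (x i / X) * (y i / Y))"
      by (simp add: sum_divide_distrib)
    also have "\<dots> \<le> (\<Sum>i\<in>I. (x i / X) powr a / a + (y i / Y) powr b / b)"
      using assms pos by (intro sum_mono Youngs_inequality) auto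
    also have "\<dots> = (\<Sum>i\<in>I. x i powr a) / X powr a / a + (\<Sum>i\<in>I. y i powr b) / Y powr b / b"
      using assms pos by (simp add: sum.distrib powr_divide sum_divide_distrib)
    also have "\<dots> = 1"
      using assms pos by (subst Xa[symmetric], subst Yb[symmetric]) simp
    finally show ?thesis using pos by (simp add: field_simps flip: X_def Y_def)
  qed
qed

lemma Minkowski_inequality_sum:
  fixes x y :: "'a \<Rightarrow> real"
  assumes p: "1 \<le> p" and fin: "finite I"
    and nn: "\<And>i. i \<in> I \<Longrightarrow> 0 \<le> x i" "\<And>i. i \<in> I \<Longrightarrow> 0 \<le> y i"
  shows "(\<Sum>i\<in>I. (x i + y i) powr p) powr (1/p)
    \<le> (\<Sum>i\<in>I. x i powr p) powr (1/p) + (\<Sum>i\<in>I. y i powr p) powr (1/p)"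
proof -
  define X where "X = (\<Sum>i\<in>I. x i powr p) powr (1/p)"
  define Y where "Y = (\<Sum>i\<in>I. y i powr p) powr (1/p)"
  have Xp: "X powr p = (\<Sum>i\<in>I. x i powr p)" and Yp: "Y powr p = (\<Sum>i\<in>I. y i powr p)"
    using p by (auto simp: X_def Y_def powr_powr sum_nonneg)
  have XY: "X \<ge> 0" "Y \<ge> 0" by (auto simp: X_def Y_def)
  consider "X = 0" | "Y = 0" | "X > 0" "Y > 0" using XY by linarith
  then have "(\<Sum>i\<in>I. (x i + y i) powr p) powr (1/p) \<le> X + Y"
  proof cases
    case 1
    then have "\<forall>i\<in>I. x i = 0"
      using fin by (auto simp: X_def sum_nonneg_eq_0_iff)
    then show ?thesis using XY by (simp add: Y_def)
  next
    case 2
    then have "\<forall>i\<in>I. y i = 0"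
      using fin by (auto simp: Y_def sum_nonneg_eq_0_iff)
    then show ?thesis using XY by (simp add: X_def)
  next
    case 3
    \<comment> \<open>With this l, (x + y)/(X + Y) is the convex combination of x/X and y/Y with
      weights l and 1 - l, so Jensen replaces the usual detour through Hoelder.\<close>
    define l where "l = X / (X + Y)"
    have l: "0 \<le> l" "l \<le> 1" using 3 by (auto simp: l_def)
    have lX: "l * (X + Y) = X" and lY: "(1 - l) * (X + Y) = Y"
      using 3 by (auto simp: l_def field_simps)
    have "(x i + y i) powr p \<le> (X + Y) powr p * (l * (x i / X) powr p + (1 - l) * (y i / Y) powr p)"
      if "i \<in> I" for i
    proof -
      have "(X + Y) * (l * (x i / X) + (1 - l) * (y i / Y))
        = (l * (X + Y)) * (x i / X) + ((1 - l) * (X + Y)) * (y i / Y)"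
        by (metis (no_types) distrib_left mult.commute mult.left_commute)
      then have "x i + y i = (X + Y) * (l * (x i / X) + (1 - l) * (y i / Y))"
        unfolding lX lY using 3 by simp
      then have "(x i + y i) powr p = (X + Y) powr p * (l * (x i / X) + (1 - l) * (y i / Y)) powr p"
        using 3 l nn[OF that] by (simp add: powr_mult)
      also have "\<dots> \<le> (X + Y) powr p * (l * (x i / X) powr p + (1 - l) * (y i / Y) powr p)"
        using jensen_powr[of p "{True, False}" "\<lambda>c. if c then l else 1 - l"
            "\<lambda>c. if c then x i / X else y i / Y"] 3 l nn[OF that] p
        by (intro mult_left_mono) auto
      finally show ?thesis .
    qed
    then have "(\<Sum>i\<in>I. (x i + y i) powr p)
      \<le> (\<Sum>i\<in>I. (X + Y) powr p * (l * (x i / X) powr p + (1 - l) * (y i / Y) powr p))"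
      by (rule sum_mono)
    also have "\<dots> = (X + Y) powr p * (l * ((\<Sum>i\<in>I. x i powr p) / X powr p)
        + (1 - l) * ((\<Sum>i\<in>I. y i powr p) / Y powr p))"
      using 3 nn by (simp add: powr_divide distrib_left sum.distrib sum_divide_distrib sum_distrib_left)
    also have "\<dots> = (X + Y) powr p"
      using 3 by (simp flip: Xp Yp)
    finally have "(\<Sum>i\<in>I. (x i + y i) powr p) powr (1/p) \<le> ((X + Y) powr p) powr (1/p)"
      using p by (intro powr_mono2) (auto intro!: sum_nonneg)
    then show ?thesis using 3 p by (simp add: powr_powr)
  qed
  then show ?thesis by (simp add: X_def Y_def)
qed

section \<open>Greedy choice of the points\<close>

lemma maurey_greedy_step:
  fixes f :: "'a::real_vector \<Rightarrow> real"
  assumes conv: "convex_on UNIV f"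
    and two: "\<And>x a b. a \<in> S \<Longrightarrow> b \<in> S \<Longrightarrow> f (x + (a - b)) + f (x - (a - b)) \<le> 2 * f x + 2 * c"
    and A: "A \<in> convex hull S"
  shows "\<exists>b\<in>S. f (x + (b - A)) \<le> f x + c"
proof -
  obtain T w where T: "finite T" "T \<subseteq> S" "\<And>a. a \<in> T \<Longrightarrow> 0 \<le> w a" "sum w T = 1"
    and Aeq: "(\<Sum>a\<in>T. w a *\<^sub>R a) = A"
    using A unfolding convex_hull_explicit by blast
  have T0: "T \<noteq> {}" using T by auto
  have "f (x + (b - A)) \<le> (\<Sum>a\<in>T. w a * f (x + (b - a)))" for b
  proof -
    have "x + (b - A) = (\<Sum>a\<in>T. w a *\<^sub>R (x + (b - a)))"
      using T by (simp add: algebra_simps sum.distrib sum_subtractf flip: Aeq scaleR_sum_left)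
    then show ?thesis
      using convex_on_sum[OF T(1) T0 conv T(4), of "\<lambda>a. x + (b - a)"] T by auto
  qed
  then have "(\<Sum>b\<in>T. w b * f (x + (b - A))) \<le> (\<Sum>b\<in>T. w b * (\<Sum>a\<in>T. w a * f (x + (b - a))))"
    using T by (intro sum_mono mult_left_mono) auto
  also have "\<dots> = (\<Sum>b\<in>T. \<Sum>a\<in>T. w b * w a * f (x + (b - a)))"
    by (simp add: sum_distrib_left mult.assoc)
  also have "\<dots> = ((\<Sum>b\<in>T. \<Sum>a\<in>T. w b * w a * f (x + (b - a)))
                + (\<Sum>b\<in>T. \<Sum>a\<in>T. w b * w a * f (x + (a - b)))) / 2"
    by (subst (3) sum.swap) (simp add: mult.commute)
  also have "\<dots> = (\<Sum>b\<in>T. \<Sum>a\<in>T. w b * w a * ((f (x + (b - a)) + f (x - (b - a))) / 2))"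
    by (simp add: sum.distrib add_divide_distrib sum_divide_distrib algebra_simps)
  also have "\<dots> \<le> (\<Sum>b\<in>T. \<Sum>a\<in>T. w b * w a * (f x + c))"
  proof (intro sum_mono mult_left_mono)
    fix a b assume "b \<in> T" "a \<in> T"
    then show "(f (x + (b - a)) + f (x - (b - a))) / 2 \<le> f x + c"
      using two[of b a x] T(2) by (auto simp: subset_iff field_simps)
    show "0 \<le> w b * w a" using T \<open>b \<in> T\<close> \<open>a \<in> T\<close> by simp
  qed
  also have "\<dots> = f x + c"
    using T by (simp flip: sum_distrib_left sum_distrib_right)
  finally have le: "(\<Sum>b\<in>T. w b * f (x + (b - A))) \<le> f x + c" .
  show ?thesis
  proof (rule ccontr)
    assume "\<not> ?thesis"
    then have gt: "f x + c < f (x + (b - A))" if "b \<in> T" for b using that T by force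
    obtain b where b: "b \<in> T" "w b > 0"
      using T by (metis sum_nonpos not_less zero_less_one)
    have "(\<Sum>b\<in>T. w b * (f x + c)) < (\<Sum>b\<in>T. w b * f (x + (b - A)))"
    proof (rule sum_strict_mono_ex1[OF T(1)])
      show "\<forall>b\<in>T. w b * (f x + c) \<le> w b * f (x + (b - A))"
        using T(3) gt by (simp add: mult_left_mono less_imp_le)
      show "\<exists>b\<in>T. w b * (f x + c) < w b * f (x + (b - A))"
        using b gt by (intro bexI[of _ b] mult_strict_left_mono) auto
    qed
    then show False using le T by (simp flip: sum_distrib_right)
  qed
qed

lemma maurey_greedy:
  fixes f :: "'a::real_vector \<Rightarrow> real"
  assumes "convex_on UNIV f" "f 0 = 0"
    and "\<And>x a b. a \<in> S \<Longrightarrow> b \<in> S \<Longrightarrow> f (x + (a - b)) + f (x - (a - b)) \<le> 2 * f x + 2 * c"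
    and "A \<in> convex hull S"
  shows "\<exists>X. (\<forall>i<k. X i \<in> S) \<and> f (\<Sum>i<k. X i - A) \<le> real k * c"
proof (induction k)
  case 0
  then show ?case using assms by auto
next
  case (Suc k)
  then obtain X where X: "\<forall>i<k. X i \<in> S" "f (\<Sum>i<k. X i - A) \<le> real k * c" by blast
  obtain b where b: "b \<in> S" "f ((\<Sum>i<k. X i - A) + (b - A)) \<le> f (\<Sum>i<k. X i - A) + c"
    using maurey_greedy_step[OF assms(1,3,4)] by blast
  have "(\<Sum>i<Suc k. (X(k := b)) i - A) = (\<Sum>i<k. X i - A) + (b - A)"
    by simp
  then show ?case
    using X b by (intro exI[of _ "X(k := b)"]) (auto simp: less_Suc_eq algebra_simps)
qed

section \<open>Spectral theorem for Hermitian matrices\<close>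

text \<open>Conjugate-linear in the first argument, so \<open>cip (u i) z\<close> is the i-th
  coordinate of z in an orthonormal basis u. Its real part is the real inner product of the library,
  which gives access to real orthogonality and Cauchy-Schwarz.\<close>

definition cip :: "complex ^ 'n \<Rightarrow> complex ^ 'n \<Rightarrow> complex" where
  "cip u v = (\<Sum>i\<in>UNIV. cnj (u $ i) * v $ i)"

lemma cip_add_right: "cip u (v + w) = cip u v + cip u w"
  and cip_add_left: "cip (u + v) w = cip u w + cip v w"
  and cip_diff_right: "cip u (v - w) = cip u v - cip u w"
  and cip_diff_left: "cip (u - v) w = cip u w - cip v w"
  and cip_minus_right: "cip u (- v) = - cip u v"
  and cip_scale_right: "cip u (c *s v) = c * cip u v"
  and cip_scale_left: "cip (c *s u) v = cnj c * cip u v"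
  and cip_zero_right: "cip u 0 = 0"
  and cip_zero_left: "cip 0 u = 0"
  by (simp_all add: cip_def algebra_simps sum.distrib sum_subtractf sum_negf sum_distrib_left)

lemma cip_sum_right: "cip u (\<Sum>i\<in>I. f i) = (\<Sum>i\<in>I. cip u (f i))"
  by (induction I rule: infinite_finite_induct) (auto simp: cip_add_right cip_zero_right)

lemma cip_sum_left: "cip (\<Sum>i\<in>I. f i) u = (\<Sum>i\<in>I. cip (f i) u)"
  by (induction I rule: infinite_finite_induct) (auto simp: cip_add_left cip_zero_left)

lemma cnj_cip: "cnj (cip u v) = cip v u"
  by (simp add: cip_def mult.commute)

lemma cmod_cip_commute: "cmod (cip u v) = cmod (cip v u)"
  by (metis cnj_cip complex_mod_cnj)

lemma Re_cip: "Re (cip u v) = inner u v"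
  by (simp add: cip_def inner_vec_def inner_complex_def)

lemma cip_self: "cip u u = complex_of_real ((norm u)\<^sup>2)"
proof -
  have "cip u u = complex_of_real (Re (cip u u))"
    using cnj_cip[of u u] by (simp add: complex_eq_iff)
  then show ?thesis by (simp add: Re_cip power2_norm_eq_inner)
qed

lemma cmod_cip_le: "cmod (cip u v) \<le> norm u * norm v"
proof -
  \<comment> \<open>Rotating v by a phase makes the product real, which reduces the claim to the
    real Cauchy-Schwarz inequality.\<close>
  obtain c where c: "cmod c = 1" "c * cip u v = complex_of_real (cmod (cip u v))"
  proof (cases "cip u v = 0")
    case True
    then show ?thesis by (intro that[of 1]) auto
  next
    case False
    then show ?thesis
      by (intro that[of "cnj (cip u v) / cmod (cip u v)"])
        (auto simp: norm_divide complex_norm_square[symmetric] power2_eq_square mult.commute[of _ "cip u v"])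
  qed
  have n: "norm (c *s v) = norm v"
    using c by (simp add: norm_vec_def norm_mult)
  have "cmod (cip u v) = Re (cip u (c *s v))"
    using c by (simp add: cip_scale_right)
  also have "\<dots> \<le> norm u * norm (c *s v)"
    unfolding Re_cip by (rule norm_cauchy_schwarz)
  finally show ?thesis by (simp add: n)
qed

lemma cip_mult_vec: "cip u (M *v v) = cip (conj_transpose M *v u) v"
proof -
  have "cip u (M *v v) = (\<Sum>i\<in>UNIV. \<Sum>j\<in>UNIV. cnj (u $ i) * (M $ i $ j * v $ j))"
    by (simp add: cip_def matrix_vector_mult_def sum_distrib_left)
  also have "\<dots> = (\<Sum>j\<in>UNIV. \<Sum>i\<in>UNIV. cnj (u $ i) * (M $ i $ j * v $ j))"
    by (rule sum.swap)
  also have "\<dots> = cip (conj_transpose M *v u) v"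
    by (simp add: cip_def matrix_vector_mult_def conj_transpose_def sum_distrib_left sum_distrib_right
        mult.commute mult.left_commute)
  finally show ?thesis .
qed

lemma conj_transpose_conj_transpose: "conj_transpose (conj_transpose M) = M"
  and conj_transpose_add: "conj_transpose (M + N) = conj_transpose M + conj_transpose N"
  and conj_transpose_diff: "conj_transpose (M - N) = conj_transpose M - conj_transpose N"
  by (simp_all add: conj_transpose_def vec_eq_iff)

lemma conj_transpose_mult: "conj_transpose (M ** N) = conj_transpose N ** conj_transpose M"
  by (simp add: conj_transpose_def matrix_matrix_mult_def vec_eq_iff mult.commute)

lemma hermitian_gram: "conj_transpose (conj_transpose M ** M) = conj_transpose M ** M"
  by (simp add: conj_transpose_mult conj_transpose_conj_transpose)

lemma norm_mult_vec_sq: "complex_of_real ((norm (M *v v))\<^sup>2) = cip v ((conj_transpose M ** M) *v v)"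
  by (simp only: cip_self[symmetric] cip_mult_vec[of _ "conj_transpose M"] conj_transpose_conj_transpose
      matrix_vector_mul_assoc[symmetric])

section \<open>Orthonormal bases and Bessel families\<close>

definition onb :: "('n \<Rightarrow> complex ^ 'n) \<Rightarrow> bool" where
  "onb u \<longleftrightarrow> (\<forall>i j. cip (u i) (u j) = (if i = j then 1 else 0))"

text \<open>Bessel's inequality itself serves as the definition. It also admits orthonormal families
  padded with zero vectors, which is what the left singular vectors of a singular matrix
  are.\<close>

definition bessel :: "('n \<Rightarrow> complex ^ 'n) \<Rightarrow> bool" where
  "bessel u \<longleftrightarrow> (\<forall>z. (\<Sum>i\<in>UNIV. (cmod (cip (u i) z))\<^sup>2) \<le> (norm z)\<^sup>2)"

definition column_matrix :: "('n \<Rightarrow> complex ^ 'n) \<Rightarrow> complex ^ 'n ^ 'n" where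
  "column_matrix u = (\<chi> i j. u j $ i)"

lemma conj_transpose_column_matrix_mult:
  "(conj_transpose (column_matrix u) *v z) $ i = cip (u i) z"
  by (simp add: column_matrix_def conj_transpose_def matrix_vector_mult_def cip_def)

text \<open>The family is indexed by the dimension type, so its column matrix is square and a left
  inverse is a right inverse: orthonormality alone gives completeness.\<close>

lemma column_matrix_unitary:
  assumes "onb u"
  shows "conj_transpose (column_matrix u) ** column_matrix u = mat 1"
    and "column_matrix u ** conj_transpose (column_matrix u) = mat 1"
proof -
  show "conj_transpose (column_matrix u) ** column_matrix u = mat 1"
    using assms
    by (simp add: vec_eq_iff onb_def cip_def column_matrix_def conj_transpose_def
        matrix_matrix_mult_def mat_def)
  then show "column_matrix u ** conj_transpose (column_matrix u) = mat 1"
    by (simp add: matrix_left_right_inverse)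
qed

lemma onb_parseval_cip:
  assumes "onb u"
  shows "cip x y = (\<Sum>i\<in>UNIV. cip x (u i) * cip (u i) y)"
proof -
  let ?U = "column_matrix u"
  have "cip x y = cip x (?U *v (conj_transpose ?U *v y))"
    using column_matrix_unitary[OF assms] by (simp add: matrix_vector_mul_assoc)
  also have "\<dots> = cip (conj_transpose ?U *v x) (conj_transpose ?U *v y)"
    by (simp add: cip_mult_vec conj_transpose_conj_transpose)
  also have "\<dots> = (\<Sum>i\<in>UNIV. cip x (u i) * cip (u i) y)"
    unfolding cip_def[of "conj_transpose ?U *v x"]
    by (simp add: conj_transpose_column_matrix_mult cnj_cip)
  finally show ?thesis .
qed

lemma onb_parseval:
  assumes "onb u"
  shows "(\<Sum>i\<in>UNIV. (cmod (cip (u i) z))\<^sup>2) = (norm z)\<^sup>2"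
proof -
  have "complex_of_real ((norm z)\<^sup>2) = (\<Sum>i\<in>UNIV. cip z (u i) * cip (u i) z)"
    using onb_parseval_cip[OF assms, of z z] by (simp only: cip_self)
  also have "\<dots> = (\<Sum>i\<in>UNIV. complex_of_real ((cmod (cip (u i) z))\<^sup>2))"
    by (intro sum.cong refl) (metis cnj_cip complex_norm_square mult.commute)
  also have "\<dots> = complex_of_real (\<Sum>i\<in>UNIV. (cmod (cip (u i) z))\<^sup>2)"
    by simp
  finally show ?thesis by (simp only: of_real_eq_iff)
qed

lemma onb_imp_bessel: "onb u \<Longrightarrow> bessel u"
  by (simp add: bessel_def onb_parseval)

lemma onb_norm: "onb u \<Longrightarrow> norm (u i) = 1"
  using cip_self[of "u i"] unfolding onb_def
  by (metis norm_ge_zero of_real_eq_1_iff power2_eq_1_iff neg_0_le_iff_le not_one_le_zero)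

text \<open>Bessel's inequality at z = u_i yields |u_i|^4 <= |u_i|^2.\<close>

lemma bessel_norm_le:
  assumes "bessel u"
  shows "norm (u i) \<le> 1"
proof (rule ccontr)
  assume "\<not> norm (u i) \<le> 1"
  then have gt: "norm (u i) > 1" by simp
  have "(cmod (cip (u i) (u i)))\<^sup>2 \<le> (\<Sum>j\<in>UNIV. (cmod (cip (u j) (u i)))\<^sup>2)"
    by (rule member_le_sum) auto
  also have "\<dots> \<le> (norm (u i))\<^sup>2" using assms by (simp add: bessel_def)
  finally have "((norm (u i))\<^sup>2)\<^sup>2 \<le> (norm (u i))\<^sup>2"
    unfolding cip_self norm_of_real by simp
  moreover have "(norm (u i))\<^sup>2 < ((norm (u i))\<^sup>2)\<^sup>2"
    using gt by (simp add: power_strict_increasing flip: power_mult)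
  ultimately show False by simp
qed

text \<open>The vector w is the projection of z to the span of the family. From <w, z> = <w, w>
  follows |z - w|^2 = |z|^2 - |w|^2, and |w|^2 is the sum of the squared coefficients.\<close>

lemma besselI_orthogonal:
  fixes a :: "'n \<Rightarrow> complex ^ 'n"
  assumes orth: "\<And>i j. i \<noteq> j \<Longrightarrow> cip (a i) (a j) = 0" and "\<And>i. a i = 0 \<or> norm (a i) = 1"
  shows "bessel a"
  unfolding bessel_def
proof
  fix z :: "complex ^ 'n"
  define w where "w = (\<Sum>i\<in>UNIV. cip (a i) z *s a i)"
  have aw: "cip (a i) w = cip (a i) z" for i
  proof -
    have "cip (a i) w = (\<Sum>j\<in>UNIV. cip (a j) z * cip (a i) (a j))"
      by (simp add: w_def cip_sum_right cip_scale_right)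
    also have "\<dots> = (\<Sum>j\<in>UNIV. if j = i then cip (a i) z * cip (a i) (a i) else 0)"
      using orth by (intro sum.cong) auto
    also have "\<dots> = cip (a i) z * cip (a i) (a i)" by simp
    also have "\<dots> = cip (a i) z"
      using assms(2)[of i] by (auto simp: cip_self cip_zero_left)
    finally show ?thesis .
  qed
  have sq: "cip w y = (\<Sum>i\<in>UNIV. complex_of_real ((cmod (cip (a i) z))\<^sup>2))"
    if "\<And>i. cip (a i) y = cip (a i) z" for y
    unfolding w_def cip_sum_left cip_scale_left that
    by (simp add: complex_norm_square mult.commute del: of_real_power)
  have ww: "cip w z = cip w w"
    using sq[of z] sq[of w] aw by simp
  then have zw: "cip z w = cip w w"
    using cnj_cip[of w z] cnj_cip[of w w] by simp
  have "cip (z - w) (z - w) = cip z z - cip w w"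
    by (simp add: cip_diff_left cip_diff_right ww zw)
  then have "complex_of_real ((norm (z - w))\<^sup>2) = complex_of_real ((norm z)\<^sup>2 - (norm w)\<^sup>2)"
    by (simp add: cip_self)
  then have "(norm (z - w))\<^sup>2 = (norm z)\<^sup>2 - (norm w)\<^sup>2"
    using of_real_eq_iff by blast
  then have "(norm w)\<^sup>2 \<le> (norm z)\<^sup>2" by (metis diff_ge_0_iff_ge zero_le_power2)
  moreover have "complex_of_real ((norm w)\<^sup>2) = complex_of_real (\<Sum>i\<in>UNIV. (cmod (cip (a i) z))\<^sup>2)"
    using sq[of w] aw by (simp add: cip_self)
  then have "(norm w)\<^sup>2 = (\<Sum>i\<in>UNIV. (cmod (cip (a i) z))\<^sup>2)"
    by (simp only: of_real_eq_iff)
  ultimately show "(\<Sum>i\<in>UNIV. (cmod (cip (a i) z))\<^sup>2) \<le> (norm z)\<^sup>2"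
    by simp
qed

section \<open>Existence of an orthonormal eigenbasis\<close>

lemma exists_cip_orthogonal:
  fixes u :: "'n \<Rightarrow> complex ^ 'n"
  assumes "J \<noteq> UNIV"
  shows "\<exists>v. v \<noteq> 0 \<and> (\<forall>j\<in>J. cip (u j) v = 0)"
proof -
  \<comment> \<open>Complex orthogonality to u_j is real orthogonality to both u_j and i u_j. These
    are at most 2 |J| vectors in a space of real dimension 2 d, so a nonzero vector orthogonal to
    all of them is left.\<close>
  let ?B = "u ` J \<union> (\<lambda>j. \<i> *s u j) ` J"
  have fin: "finite ?B" by simp
  have "dim ?B \<le> card ?B" using fin by (rule dim_le_card')
  also have "\<dots> \<le> card J + card J"
    by (meson add_mono card_Un_le card_image_le finite order_trans)
  also have "\<dots> < DIM(complex ^ 'n)"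
    using assms psubset_card_mono[of UNIV J] by (auto simp: psubset_eq)
  finally obtain v where v: "v \<noteq> 0" "\<And>y. y \<in> span ?B \<Longrightarrow> orthogonal v y"
    using orthogonal_to_subspace_exists by blast
  have "cip (u j) v = 0" if "j \<in> J" for j
  proof (rule complex_eqI)
    have "inner v (u j) = 0" "inner v (\<i> *s u j) = 0"
      using v(2)[of "u j"] v(2)[of "\<i> *s u j"] that by (auto simp: orthogonal_def intro: span_base)
    then have 1: "Re (cip (u j) v) = 0" and 2: "Re (cip (\<i> *s u j) v) = 0"
      by (auto simp: Re_cip inner_commute)
    show "Re (cip (u j) v) = Re 0" using 1 by simp
    show "Im (cip (u j) v) = Im 0" using 2 by (simp add: cip_scale_left)
  qed
  then show ?thesis using v by blast
qed

lemma linear_coeff_zero_if_quadratic_nonneg: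
  fixes b c :: real
  assumes "\<And>t. 0 \<le> 2 * t * b + t\<^sup>2 * c"
  shows "b = 0"
proof (rule ccontr)
  assume b: "b \<noteq> 0"
  \<comment> \<open>This t satisfies t^2 (|c| + 1) = - t b, so the quadratic expression is at most t
    b, which is negative.\<close>
  define t where "t = - b / (\<bar>c\<bar> + 1)"
  have "t * (\<bar>c\<bar> + 1) = - b" by (simp add: t_def)
  moreover have "t\<^sup>2 * c \<le> t\<^sup>2 * (\<bar>c\<bar> + 1)" by (intro mult_left_mono) auto
  ultimately have "t\<^sup>2 * c \<le> - t * b" by (simp add: power2_eq_square mult.assoc)
  then have "0 \<le> t * b" using assms[of t] by simp
  moreover have "t * b < 0" using b by (simp add: t_def divide_neg_pos power2_eq_square[symmetric])
  ultimately show False by simp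
qed

text \<open>A maximiser of the quadratic form on the unit sphere of the orthogonal complement of the
  eigenvectors found so far is a further eigenvector.\<close>

lemma hermitian_eigenvector_orthogonal:
  fixes H :: "complex ^ 'n ^ 'n" and J :: "'n set"
  assumes H: "conj_transpose H = H" and J: "J \<noteq> UNIV"
    and eig: "\<And>j. j \<in> J \<Longrightarrow> H *v u j = complex_of_real (l j) *s u j"
  shows "\<exists>v m. norm v = 1 \<and> (\<forall>j\<in>J. cip (u j) v = 0) \<and> H *v v = complex_of_real m *s v"
proof -
  define W where "W = {v. \<forall>j\<in>J. cip (u j) v = 0}"
  define Q where "Q v = Re (cip v (H *v v))" for v
  have add: "v + w \<in> W" and sc: "c *s v \<in> W" and HW: "H *v v \<in> W" if "v \<in> W" "w \<in> W" for v w c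
    using that by (auto simp: W_def cip_add_right cip_scale_right cip_mult_vec H eig cip_scale_left)
  have scR: "r *\<^sub>R v = complex_of_real r *s v" for r and v :: "complex ^ 'n"
    by (simp add: vec_eq_iff) (simp add: scaleR_conv_of_real)
  have contcip: "continuous_on UNIV (\<lambda>v. cip (f v) (g v))"
    if "continuous_on UNIV f" "continuous_on UNIV g"
    for f g :: "complex ^ 'n \<Rightarrow> complex ^ 'n"
    unfolding cip_def using that by (intro continuous_intros)
  have contH: "continuous_on UNIV (\<lambda>v. H *v v)"
    unfolding matrix_vector_mult_def by (intro continuous_intros)
  have Wcl: "closed W"
  proof -
    have "W = (\<Inter>j\<in>J. (\<lambda>v. cip (u j) v) -` {0})" by (auto simp: W_def)
    moreover have "closed ((\<lambda>v. cip (u j) v) -` {0})" for j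
      using contcip[of "\<lambda>v. u j" "\<lambda>v. v"] by (intro closed_vimage) auto
    ultimately show ?thesis by auto
  qed
  have comp: "compact (sphere 0 1 \<inter> W)"
    using Wcl by (intro compact_Int_closed) auto
  obtain v0 where v0: "v0 \<noteq> 0" "v0 \<in> W"
    using exists_cip_orthogonal[OF J, of u] by (auto simp: W_def)
  have normalise: "(1 / norm w) *\<^sub>R w \<in> sphere 0 1 \<inter> W" if "w \<noteq> 0" "w \<in> W" for w
    using that sc[OF that(2) that(2), of "complex_of_real (1 / norm w)"] unfolding scR[symmetric] by simp
  have "continuous_on (sphere 0 1 \<inter> W) Q"
    unfolding Q_def using contcip[OF continuous_on_id contH]
    by (intro continuous_intros) (auto intro: continuous_on_subset)
  then obtain v where v: "v \<in> sphere 0 1 \<inter> W" and vmax: "\<And>w. w \<in> sphere 0 1 \<inter> W \<Longrightarrow> Q w \<le> Q v"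
    using continuous_attains_sup[OF comp] normalise[OF v0] by blast
  define m where "m = Q v"
  have Qsc: "Q (r *\<^sub>R w) = r\<^sup>2 * Q w" for r w
    by (simp add: Q_def scR cip_scale_right cip_scale_left vector_scalar_commute power2_eq_square
        del: of_real_power)
  have Qle: "Q w \<le> m * (norm w)\<^sup>2" if w: "w \<in> W" for w
  proof (cases "w = 0")
    case True
    then show ?thesis by (simp add: Q_def cip_zero_left)
  next
    case False
    from vmax[OF normalise[OF False w]] show ?thesis
      using False by (simp add: Qsc m_def power_divide field_simps)
  qed
  have nv: "norm v = 1" and vW: "v \<in> W" using v by auto
  \<comment> \<open>On W the function m |x|^2 - Q x is nonnegative and vanishes at the maximiser v,
    so its linear coefficient in every direction w of W is zero.\<close>
  have Re0: "inner (complex_of_real m *s v - H *v v) w = 0" if w: "w \<in> W" for w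
  proof (rule linear_coeff_zero_if_quadratic_nonneg)
    fix t :: real
    have "v + t *\<^sub>R w \<in> W" using add vW w sc unfolding scR by blast
    from Qle[OF this] have "0 \<le> m * (norm (v + t *\<^sub>R w))\<^sup>2 - Q (v + t *\<^sub>R w)" by simp
    also have "(norm (v + t *\<^sub>R w))\<^sup>2 = 1 + 2 * t * inner v w + t\<^sup>2 * (norm w)\<^sup>2"
      using nv unfolding power2_norm_eq_inner norm_eq_1
      by (simp add: inner_add_left inner_add_right inner_commute power2_eq_square)
    also have "Q (v + t *\<^sub>R w) = m + 2 * t * inner (H *v v) w + t\<^sup>2 * Q w"
    proof -
      have "inner v (H *v w) = inner (H *v v) w"
        by (simp add: cip_mult_vec H flip: Re_cip)
      moreover have "H *v (t *\<^sub>R w) = t *\<^sub>R (H *v w)"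
        unfolding scR by (rule vector_scalar_commute)
      ultimately show ?thesis
        unfolding m_def Q_def Re_cip
        by (simp add: matrix_vector_right_distrib inner_add_left inner_add_right inner_commute
            power2_eq_square algebra_simps)
    qed
    finally show "0 \<le> 2 * t * inner (complex_of_real m *s v - H *v v) w + t\<^sup>2 * (m * (norm w)\<^sup>2 - Q w)"
      by (simp add: inner_diff_left algebra_simps flip: scR)
  qed
  have "- 1 *s (H *v v) \<in> W" using sc[OF HW[OF vW vW]] HW[OF vW vW] by blast
  then have "complex_of_real m *s v - H *v v \<in> W"
    using add[OF sc[OF vW vW, of "complex_of_real m"]] by (fastforce simp: W_def cip_diff_right cip_scale_right)
  \<comment> \<open>The residual m v - H v belongs to W and is orthogonal to all of W, in particular
    to itself.\<close>
  from Re0[OF this] have "H *v v = complex_of_real m *s v" by simp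
  then show ?thesis using nv vW unfolding W_def by blast
qed

theorem hermitian_spectral:
  fixes H :: "complex ^ 'n ^ 'n"
  assumes H: "conj_transpose H = H"
  shows "\<exists>u l. onb u \<and> (\<forall>j. H *v u j = complex_of_real (l j) *s u j)"
proof -
  have "\<exists>u l. (\<forall>i\<in>J. \<forall>j\<in>J. cip (u i) (u j) = (if i = j then 1 else 0)) \<and>
      (\<forall>j\<in>J. H *v u j = complex_of_real (l j) *s u j)" for J :: "'n set"
    using finite[of J]
  proof (induction J rule: finite_induct)
    case empty
    then show ?case by simp
  next
    case (insert x J)
    then obtain u l where u: "\<And>i j. i \<in> J \<Longrightarrow> j \<in> J \<Longrightarrow> cip (u i) (u j) = (if i = j then 1 else 0)"
      and l: "\<And>j. j \<in> J \<Longrightarrow> H *v u j = complex_of_real (l j) *s u j" by blast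
    have "J \<noteq> UNIV" using insert by auto
    then obtain v m where v: "norm v = 1" "\<And>j. j \<in> J \<Longrightarrow> cip (u j) v = 0"
      and m: "H *v v = complex_of_real m *s v"
      using hermitian_eigenvector_orthogonal[OF H, of J u l] l by auto
    have v': "cip v (u j) = 0" if "j \<in> J" for j
      using v(2)[OF that] by (metis cnj_cip complex_cnj_zero)
    show ?case
      using insert.hyps u l v v' m cip_self[of v]
      by (intro exI[of _ "u(x := v)"] exI[of _ "l(x := m)"]) auto
  qed
  from this[of UNIV] show ?thesis by (simp add: onb_def)
qed

lemma cip_quadratic_form_eigenbasis:
  fixes H :: "complex ^ 'n ^ 'n"
  assumes H: "conj_transpose H = H" and u: "onb u"
    and eig: "\<And>j. H *v u j = complex_of_real (l j) *s u j"
  shows "cip z (H *v z) = complex_of_real (\<Sum>j\<in>UNIV. (cmod (cip (u j) z))\<^sup>2 * l j)"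
proof -
  have "cip z (H *v z) = (\<Sum>j\<in>UNIV. cip z (u j) * cip (u j) (H *v z))"
    by (rule onb_parseval_cip[OF u])
  also have "\<dots> = (\<Sum>j\<in>UNIV. complex_of_real ((cmod (cip (u j) z))\<^sup>2 * l j))"
  proof (intro sum.cong refl)
    fix j
    have "cip (u j) (H *v z) = complex_of_real (l j) * cip (u j) z"
      by (simp add: cip_mult_vec H eig cip_scale_left)
    moreover have "cip z (u j) * cip (u j) z = complex_of_real ((cmod (cip (u j) z))\<^sup>2)"
      by (metis cnj_cip complex_norm_square mult.commute)
    ultimately show "cip z (u j) * cip (u j) (H *v z) = complex_of_real ((cmod (cip (u j) z))\<^sup>2 * l j)"
      by (simp add: mult.left_commute mult.commute)
  qed
  finally show ?thesis by simp
qed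

section \<open>The characteristic polynomial in an eigenbasis\<close>

definition const_poly_matrix :: "complex ^ 'n ^ 'n \<Rightarrow> complex poly ^ 'n ^ 'n" where
  "const_poly_matrix M = (\<chi> i j. [:M $ i $ j:])"

lemma sum_const_poly: "(\<Sum>i\<in>I. [:f i:]) = [:\<Sum>i\<in>I. f i:]"
  by (induction I rule: infinite_finite_induct) auto

lemma const_poly_matrix_mult:
  "const_poly_matrix (M ** N) = const_poly_matrix M ** const_poly_matrix N"
  by (simp add: const_poly_matrix_def matrix_matrix_mult_def vec_eq_iff mult.commute
      flip: sum_const_poly)

text \<open>With U the matrix of eigenvectors and D the diagonal matrix of eigenvalues, H U = U D
  lifts to (x I - H) U = U (x I - D) over the polynomial ring. Determinants are multiplicative
  there, and det U cancels because U has an inverse and the ring is an integral domain.\<close>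

lemma char_poly_hma_eigenbasis:
  fixes H :: "complex ^ 'n ^ 'n"
  assumes u: "onb u" and eig: "\<And>j. H *v u j = l j *s u j"
  shows "char_poly_hma H = (\<Prod>j\<in>UNIV. [:- l j, 1:])"
proof -
  define U where "U = column_matrix u"
  define D :: "complex ^ 'n ^ 'n" where "D = (\<chi> i j. if i = j then l j else 0)"
  define E :: "complex ^ 'n ^ 'n \<Rightarrow> complex poly ^ 'n ^ 'n"
    where "E M = (\<chi> i j. (if i = j then [:0, 1:] else 0) - [: M $ i $ j :])" for M
  let ?C = "const_poly_matrix U"
  have HU: "H ** U = U ** D"
  proof -
    have "(H ** U) $ i $ j = (H *v u j) $ i" for i j
      by (simp add: U_def column_matrix_def matrix_matrix_mult_def matrix_vector_mult_def)
    moreover have "(U ** D) $ i $ j = l j * u j $ i" for i j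
      by (simp add: U_def D_def column_matrix_def matrix_matrix_mult_def if_distrib[of "\<lambda>x. _ * x"]
          cong: if_cong)
    ultimately show ?thesis by (simp add: vec_eq_iff eig)
  qed
  have left: "E M ** ?C = (\<chi> i j. [:0, 1:] * [:U $ i $ j:]) - const_poly_matrix (M ** U)" for M
    unfolding const_poly_matrix_mult
    by (simp add: vec_eq_iff E_def const_poly_matrix_def matrix_matrix_mult_def left_diff_distrib
        sum_subtractf if_distrib[of "\<lambda>x. x * _"] cong: if_cong
        del: mult_pCons_left mult_pCons_right)
  have right: "?C ** E M = (\<chi> i j. [:0, 1:] * [:U $ i $ j:]) - const_poly_matrix (U ** M)" for M
    unfolding const_poly_matrix_mult
    by (simp add: vec_eq_iff E_def const_poly_matrix_def matrix_matrix_mult_def right_diff_distrib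
        sum_subtractf if_distrib[of "\<lambda>x. _ * x"] mult.commute cong: if_cong
        del: mult_pCons_left mult_pCons_right)
  have "det (E H) * det ?C = det ?C * det (E D)"
    by (metis HU left right det_mul)
  moreover have "det ?C \<noteq> 0"
  proof
    assume "det ?C = 0"
    then have "det (const_poly_matrix (U ** conj_transpose U)) = 0"
      by (simp add: const_poly_matrix_mult det_mul)
    moreover have "const_poly_matrix (U ** conj_transpose U) = (mat 1 :: complex poly ^ 'n ^ 'n)"
      using column_matrix_unitary(2)[OF u]
      by (simp add: U_def const_poly_matrix_def mat_def vec_eq_iff)
    ultimately show False by simp
  qed
  ultimately have "det (E H) = det (E D)" by (simp add: mult.commute)
  also have "\<dots> = (\<Prod>j\<in>UNIV. [:- l j, 1:])"
    by (subst det_diagonal) (auto simp: E_def D_def)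
  finally show ?thesis by (simp add: char_poly_hma_def E_def)
qed

lemma order_prod_linear:
  fixes l :: "'a \<Rightarrow> 'b::idom"
  assumes "finite J"
  shows "order z (\<Prod>j\<in>J. [:- l j, 1:]) = card {j \<in> J. l j = z}"
  using assms
proof (induction J rule: finite_induct)
  case empty
  then show ?case by simp
next
  case (insert x J)
  have nz: "(\<Prod>j\<in>J. [:- l j, 1:]) \<noteq> 0" using insert by auto
  have "order z (\<Prod>j\<in>insert x J. [:- l j, 1:]) = order z [:- l x, 1:] + card {j \<in> J. l j = z}"
    using insert nz by (simp add: order_mult del: mult_pCons_left)
  also have "order z [:- l x, 1:] = (if l x = z then 1 else 0)"
    using order_power_n_n[of z 1] by (auto intro: order_0I)
  also have "\<dots> + card {j \<in> J. l j = z} = card {j \<in> insert x J. l j = z}"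
  proof -
    have "{j \<in> insert x J. l j = z} = (if l x = z then insert x {j \<in> J. l j = z} else {j \<in> J. l j = z})"
      by auto
    then show ?thesis using insert by auto
  qed
  finally show ?case .
qed

section \<open>Schatten norms through singular values\<close>

definition schatten_pow :: "real \<Rightarrow> complex ^ 'n ^ 'n \<Rightarrow> real" where
  "schatten_pow p X = (let q = char_poly_hma (conj_transpose X ** X) in
     \<Sum>z\<in>{z. poly q z = 0}. real (order z q) * cmod z powr (p / 2))"

lemma schatten_norm_eq: "schatten_norm p X = schatten_pow p X powr (1 / p)"
  by (simp add: schatten_norm_def schatten_pow_def Let_def)

lemma schatten_pow_nonneg: "0 \<le> schatten_pow p X"
  by (auto simp: schatten_pow_def Let_def intro!: sum_nonneg)

lemma schatten_norm_nonneg: "0 \<le> schatten_norm p X"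
  by (simp add: schatten_norm_eq)

lemma schatten_norm_powr: "p \<noteq> 0 \<Longrightarrow> schatten_norm p X powr p = schatten_pow p X"
  by (simp add: schatten_norm_eq powr_powr schatten_pow_nonneg)

text \<open>The order of a root z is the number of indices j with \<open>l j = z\<close>, so
  grouping a sum over indices by eigenvalue gives the sum over roots with multiplicity. This is the
  bridge from the definition by roots to eigenbases.\<close>

lemma schatten_pow_gram_eigenbasis:
  fixes X :: "complex ^ 'n ^ 'n"
  assumes u: "onb u" and eig: "\<And>j. (conj_transpose X ** X) *v u j = l j *s u j"
  shows "schatten_pow p X = (\<Sum>j\<in>UNIV. cmod (l j) powr (p / 2))"
proof -
  define q where "q = char_poly_hma (conj_transpose X ** X)"
  have q: "q = (\<Prod>j\<in>UNIV. [:- l j, 1:])"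
    unfolding q_def using char_poly_hma_eigenbasis[OF u eig] .
  have roots: "{z. poly q z = 0} = range l"
    by (auto simp: q poly_prod)
  have "schatten_pow p X = (\<Sum>z\<in>range l. real (card {j \<in> UNIV. l j = z}) * cmod z powr (p / 2))"
    unfolding schatten_pow_def Let_def q_def[symmetric] roots
    by (simp add: q order_prod_linear)
  also have "\<dots> = (\<Sum>z\<in>range l. \<Sum>j\<in>{j \<in> UNIV. l j = z}. cmod (l j) powr (p / 2))"
    by (intro sum.cong) auto
  also have "\<dots> = (\<Sum>j\<in>UNIV. cmod (l j) powr (p / 2))"
    by (rule sum.group) auto
  finally show ?thesis .
qed

text \<open>The right half of a singular value decomposition: right singular vectors and singular
  values in no particular order. Every such system computes the same \<open>schatten_pow\<close>, so
  it can be chosen freely.\<close>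

definition singular_system :: "complex ^ 'n ^ 'n \<Rightarrow> ('n \<Rightarrow> complex ^ 'n) \<Rightarrow> ('n \<Rightarrow> real) \<Rightarrow> bool" where
  "singular_system X b s \<longleftrightarrow> onb b \<and> (\<forall>j. 0 \<le> s j) \<and>
     (\<forall>j. (conj_transpose X ** X) *v b j = complex_of_real ((s j)\<^sup>2) *s b j)"

lemma singular_system_exists: "\<exists>b s. singular_system X b s"
proof -
  obtain b l where b: "onb b" and l: "\<And>j. (conj_transpose X ** X) *v b j = complex_of_real (l j) *s b j"
    using hermitian_spectral[OF hermitian_gram] by blast
  have "complex_of_real ((norm (X *v b j))\<^sup>2) = complex_of_real (l j)" for j
    unfolding norm_mult_vec_sq l cip_scale_right using b by (simp add: onb_def)
  then have "l j = (norm (X *v b j))\<^sup>2" for j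
    by (simp only: of_real_eq_iff)
  then show ?thesis
    unfolding singular_system_def using b l
    by (intro exI[of _ b] exI[of _ "\<lambda>j. norm (X *v b j)"]) auto
qed

lemma schatten_pow_singular_system:
  assumes "singular_system X b s"
  shows "schatten_pow p X = (\<Sum>j\<in>UNIV. s j powr p)"
proof -
  have "schatten_pow p X = (\<Sum>j\<in>UNIV. cmod (complex_of_real ((s j)\<^sup>2)) powr (p / 2))"
    using assms unfolding singular_system_def by (intro schatten_pow_gram_eigenbasis) auto
  also have "\<dots> = (\<Sum>j\<in>UNIV. s j powr p)"
  proof (intro sum.cong refl)
    fix j
    have "0 \<le> s j" using assms by (simp add: singular_system_def)
    then have "(s j)\<^sup>2 = s j powr 2" by simp
    then show "cmod (complex_of_real ((s j)\<^sup>2)) powr (p / 2) = s j powr p"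
      unfolding norm_of_real by (simp add: powr_powr)
  qed
  finally show ?thesis .
qed

lemma cip_singular_system:
  assumes "singular_system X b s"
  shows "cip (X *v b i) (X *v b j) = (if i = j then complex_of_real ((s j)\<^sup>2) else 0)"
proof -
  have "cip (X *v b i) (X *v b j) = cip (b i) ((conj_transpose X ** X) *v b j)"
    by (simp add: cip_mult_vec[of "b i" "conj_transpose X"] conj_transpose_conj_transpose
        flip: matrix_vector_mul_assoc)
  then show ?thesis
    using assms by (simp add: singular_system_def cip_scale_right onb_def)
qed

lemma norm_singular_vector:
  assumes "singular_system X b s"
  shows "norm (X *v b j) = s j"
proof -
  have "complex_of_real ((norm (X *v b j))\<^sup>2) = complex_of_real ((s j)\<^sup>2)"
    using cip_singular_system[OF assms, of j j] cip_self[of "X *v b j"] by simp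
  then have "(norm (X *v b j))\<^sup>2 = (s j)\<^sup>2" by (simp only: of_real_eq_iff)
  then show ?thesis using assms by (simp add: singular_system_def)
qed

lemma norm_mult_vec_singular_system:
  assumes "singular_system X b s"
  shows "(norm (X *v z))\<^sup>2 = (\<Sum>j\<in>UNIV. (cmod (cip (b j) z))\<^sup>2 * (s j)\<^sup>2)"
proof -
  have "complex_of_real ((norm (X *v z))\<^sup>2)
      = complex_of_real (\<Sum>j\<in>UNIV. (cmod (cip (b j) z))\<^sup>2 * (s j)\<^sup>2)"
    unfolding norm_mult_vec_sq
    using assms by (intro cip_quadratic_form_eigenbasis hermitian_gram) (auto simp: singular_system_def)
  then show ?thesis by (simp only: of_real_eq_iff)
qed

lemma power2_powr_half: "0 \<le> x \<Longrightarrow> (x\<^sup>2) powr (p / 2) = x powr p" for x :: real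
  using powr_powr[of x 2 "p / 2"] by simp

section \<open>Trace inequalities from overlaps with singular vectors\<close>

lemma bessel_sum_norm_powr_le:
  assumes v: "bessel v" and p: "2 \<le> p"
  shows "(\<Sum>i\<in>UNIV. norm (X *v v i) powr p) \<le> schatten_pow p X"
proof -
  obtain b s where bs: "singular_system X b s" using singular_system_exists by blast
  then have b: "onb b" and s: "\<And>j. 0 \<le> s j" by (auto simp: singular_system_def)
  \<comment> \<open>|X v_i|^2 is the mean of the s_j^2 with weights |<b_j, v_i>|^2. Those overlaps
    are substochastic, and p/2 >= 1 makes the power convex.\<close>
  have "(\<Sum>i\<in>UNIV. norm (X *v v i) powr p)
      = (\<Sum>i\<in>UNIV. (\<Sum>j\<in>UNIV. (cmod (cip (b j) (v i)))\<^sup>2 * (s j)\<^sup>2) powr (p / 2))"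
    by (simp add: power2_powr_half flip: norm_mult_vec_singular_system[OF bs])
  also have "\<dots> \<le> (\<Sum>j\<in>UNIV. ((s j)\<^sup>2) powr (p / 2))"
  proof (rule sum_substochastic_powr_le)
    show "(\<Sum>j\<in>UNIV. (cmod (cip (b j) (v i)))\<^sup>2) \<le> 1" for i
      using bessel_norm_le[OF v, of i] by (simp add: onb_parseval[OF b] power_le_one)
    show "(\<Sum>i\<in>UNIV. (cmod (cip (b j) (v i)))\<^sup>2) \<le> 1" for j
      using v onb_norm[OF b, of j] unfolding bessel_def cmod_cip_commute[of "b j"] by (metis one_power2)
  qed (use p in auto)
  also have "\<dots> = schatten_pow p X"
    by (simp add: schatten_pow_singular_system[OF bs] power2_powr_half s)
  finally show ?thesis .
qed

text \<open>The counterpart for p/2 <= 1, where concavity reverses Jensen. The overlaps of each b_j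
  with the family must now sum to exactly 1, hence a full orthonormal basis instead of a Bessel
  family.\<close>

lemma schatten_pow_le_onb_sum:
  assumes v: "onb v" and p: "0 < p" "p \<le> 2"
  shows "schatten_pow p X \<le> (\<Sum>i\<in>UNIV. norm (X *v v i) powr p)"
proof -
  obtain b s where bs: "singular_system X b s" using singular_system_exists by blast
  then have b: "onb b" and s: "\<And>j. 0 \<le> s j" by (auto simp: singular_system_def)
  have "schatten_pow p X = (\<Sum>j\<in>UNIV. ((s j)\<^sup>2) powr (p / 2))"
    by (simp add: schatten_pow_singular_system[OF bs] power2_powr_half s)
  also have "\<dots> = (\<Sum>j\<in>UNIV. (\<Sum>i\<in>UNIV. (cmod (cip (b j) (v i)))\<^sup>2) * ((s j)\<^sup>2) powr (p / 2))"
    by (simp add: cmod_cip_commute[of "b _"] onb_parseval[OF v] onb_norm[OF b])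
  also have "\<dots> = (\<Sum>i\<in>UNIV. \<Sum>j\<in>UNIV. (cmod (cip (b j) (v i)))\<^sup>2 * ((s j)\<^sup>2) powr (p / 2))"
    by (subst sum.swap) (simp add: sum_distrib_right)
  also have "\<dots> \<le> (\<Sum>i\<in>UNIV. (\<Sum>j\<in>UNIV. (cmod (cip (b j) (v i)))\<^sup>2 * (s j)\<^sup>2) powr (p / 2))"
    using p by (intro sum_mono jensen_powr_concave) (auto simp: onb_parseval[OF b] onb_norm[OF v])
  also have "\<dots> = (\<Sum>i\<in>UNIV. norm (X *v v i) powr p)"
    by (simp add: power2_powr_half flip: norm_mult_vec_singular_system[OF bs])
  finally show ?thesis .
qed

lemma singular_vectors_left:
  fixes X :: "complex ^ 'n ^ 'n"
  assumes bs: "singular_system X b s"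
  obtains a where "bessel a" "\<And>j. X *v b j = complex_of_real (s j) *s a j"
    "\<And>j. cip (a j) (X *v b j) = complex_of_real (s j)"
proof -
  \<comment> \<open>For \<open>s j = 0\<close> the convention 1 / 0 = 0 gives a_j = 0, so the family
    is Bessel but in general not orthonormal.\<close>
  define a where "a j = complex_of_real (1 / s j) *s (X *v b j)" for j
  have cip_a: "cip (a i) (a j) = (if i = j \<and> s j \<noteq> 0 then 1 else 0)" for i j
    by (simp add: a_def cip_scale_left cip_scale_right cip_singular_system[OF bs] power2_eq_square)
  have "bessel a"
  proof (rule besselI_orthogonal)
    fix i
    have "complex_of_real ((norm (a i))\<^sup>2) = complex_of_real (if s i \<noteq> 0 then 1 else 0)"
      unfolding cip_self[symmetric] cip_a by simp
    then have "(norm (a i))\<^sup>2 = (if s i \<noteq> 0 then 1 else 0)" by (simp only: of_real_eq_iff)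
    then have "(norm (a i))\<^sup>2 = 0 \<or> (norm (a i))\<^sup>2 = 1" by simp
    then show "a i = 0 \<or> norm (a i) = 1"
      by (auto simp: power2_eq_1_iff) (smt (verit) norm_ge_zero)
  qed (simp add: cip_a)
  moreover have Xb: "X *v b j = complex_of_real (s j) *s a j" for j
  proof (cases "s j = 0")
    case True
    then show ?thesis using norm_singular_vector[OF bs, of j] by simp
  next
    case False
    then show ?thesis by (simp add: a_def vector_smult_assoc)
  qed
  moreover have "cip (a j) (X *v b j) = complex_of_real (s j)" for j
    unfolding Xb cip_scale_right cip_a by simp
  ultimately show ?thesis using that by blast
qed

text \<open>A variational bound whose equality case is the pair of singular families of X. It
  supplies the triangle inequality.\<close>

lemma sum_cip_powr_le_schatten_pow:
  fixes X :: "complex ^ 'n ^ 'n"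
  assumes u: "bessel u" and v: "bessel v" and p: "1 \<le> p"
  shows "(\<Sum>i\<in>UNIV. cmod (cip (u i) (X *v v i)) powr p) \<le> schatten_pow p X"
proof -
  obtain b s where bs: "singular_system X b s" using singular_system_exists by blast
  then have b: "onb b" and s: "\<And>j. 0 \<le> s j" by (auto simp: singular_system_def)
  obtain a where a: "bessel a" and Xb: "\<And>j. X *v b j = complex_of_real (s j) *s a j"
    using singular_vectors_left[OF bs] by metis
  \<comment> \<open>Expanding in singular vectors gives the weights |<u_i, a_j>| |<b_j, v_i>|. By
    the arithmetic-geometric mean they are at most D, the average of two substochastic
    matrices.\<close>
  define D where "D i j = ((cmod (cip (u i) (a j)))\<^sup>2 + (cmod (cip (b j) (v i)))\<^sup>2) / 2" for i j
  have entry: "cmod (cip (u i) (X *v v i)) \<le> (\<Sum>j\<in>UNIV. D i j * s j)" for i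
  proof -
    have "cip (u i) (X *v v i) = (\<Sum>j\<in>UNIV. cip (u i) (X *v b j) * cip (b j) (v i))"
      unfolding cip_mult_vec by (rule onb_parseval_cip[OF b])
    also have "cmod \<dots> \<le> (\<Sum>j\<in>UNIV. cmod (cip (u i) (X *v b j) * cip (b j) (v i)))"
      by (rule norm_sum)
    also have "\<dots> \<le> (\<Sum>j\<in>UNIV. D i j * s j)"
    proof (rule sum_mono)
      fix j
      have "cmod (cip (u i) (a j)) * cmod (cip (b j) (v i)) \<le> D i j"
        unfolding D_def using sum_squares_bound[of "cmod (cip (u i) (a j))" "cmod (cip (b j) (v i))"]
        by simp
      from mult_right_mono[OF this s[of j]]
      show "cmod (cip (u i) (X *v b j) * cip (b j) (v i)) \<le> D i j * s j"
        using s[of j] by (simp add: Xb cip_scale_right norm_mult mult.commute mult.left_commute)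
    qed
    finally show ?thesis .
  qed
  have "(\<Sum>i\<in>UNIV. cmod (cip (u i) (X *v v i)) powr p) \<le> (\<Sum>i\<in>UNIV. (\<Sum>j\<in>UNIV. D i j * s j) powr p)"
    using p entry by (intro sum_mono powr_mono2) auto
  also have "\<dots> \<le> (\<Sum>j\<in>UNIV. s j powr p)"
  proof (rule sum_substochastic_powr_le[OF p])
    have sq: "(\<Sum>j\<in>UNIV. (cmod (cip (w j) z))\<^sup>2) \<le> 1" if "bessel w" "norm z \<le> 1"
      for w and z :: "complex ^ 'n"
      using that unfolding bessel_def by (meson order_trans norm_ge_zero power_le_one)
    have av: "(P + Q) / 2 \<le> 1" if "P \<le> 1" "Q \<le> 1" for P Q :: real using that by simp
    show "(\<Sum>j\<in>UNIV. D i j) \<le> 1" for i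
      unfolding D_def sum_divide_distrib[symmetric] sum.distrib cmod_cip_commute[of "u i"]
      by (intro av sq a onb_imp_bessel b bessel_norm_le[OF u] bessel_norm_le[OF v])
    show "(\<Sum>i\<in>UNIV. D i j) \<le> 1" for j
      unfolding D_def sum_divide_distrib[symmetric] sum.distrib cmod_cip_commute[of "b j"]
      by (intro av sq u v bessel_norm_le[OF a] bessel_norm_le[OF onb_imp_bessel[OF b]])
  qed (auto simp: D_def s)
  finally show ?thesis by (simp add: schatten_pow_singular_system[OF bs])
qed

text \<open>The singular vectors of X + Y satisfy s_j = <a_j, (X + Y) b_j>. Splitting this entry,
  Minkowski separates X from Y, and each part is bounded by
  \<open>sum_cip_powr_le_schatten_pow\<close>.\<close>

lemma schatten_norm_triangle:
  assumes p: "1 \<le> p"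
  shows "schatten_norm p (X + Y) \<le> schatten_norm p X + schatten_norm p Y"
proof -
  obtain b s where bs: "singular_system (X + Y) b s" using singular_system_exists by blast
  then have b: "bessel b" and s: "\<And>j. 0 \<le> s j"
    by (auto simp: singular_system_def onb_imp_bessel)
  obtain a where a: "bessel a" and sj: "\<And>j. cip (a j) ((X + Y) *v b j) = complex_of_real (s j)"
    using singular_vectors_left[OF bs] by metis
  let ?x = "\<lambda>j. cmod (cip (a j) (X *v b j))" and ?y = "\<lambda>j. cmod (cip (a j) (Y *v b j))"
  have "s j \<le> ?x j + ?y j" for j
  proof -
    have "s j = cmod (cip (a j) ((X + Y) *v b j))" using s by (simp add: sj)
    then show ?thesis
      by (simp add: matrix_vector_mult_add_rdistrib cip_add_right norm_triangle_ineq)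
  qed
  then have "schatten_pow p (X + Y) \<le> (\<Sum>j\<in>UNIV. (?x j + ?y j) powr p)"
    unfolding schatten_pow_singular_system[OF bs] using s p by (intro sum_mono powr_mono2) auto
  then have "schatten_norm p (X + Y) \<le> (\<Sum>j\<in>UNIV. (?x j + ?y j) powr p) powr (1 / p)"
    unfolding schatten_norm_eq using p by (intro powr_mono2) (auto simp: schatten_pow_nonneg)
  also have "\<dots> \<le> (\<Sum>j\<in>UNIV. ?x j powr p) powr (1 / p) + (\<Sum>j\<in>UNIV. ?y j powr p) powr (1 / p)"
    using p by (intro Minkowski_inequality_sum) auto
  also have "\<dots> \<le> schatten_norm p X + schatten_norm p Y"
    unfolding schatten_norm_eq using p
    by (intro add_mono powr_mono2 sum_cip_powr_le_schatten_pow a b) (auto intro!: sum_nonneg)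
  finally show ?thesis .
qed

lemma schatten_norm_scaleR:
  assumes p: "0 < p"
  shows "schatten_norm p (r *\<^sub>R X) = \<bar>r\<bar> * schatten_norm p X"
proof -
  obtain b s where bs: "singular_system X b s" using singular_system_exists by blast
  then have s: "\<And>j. 0 \<le> s j" by (auto simp: singular_system_def)
  have "conj_transpose (r *\<^sub>R X) ** (r *\<^sub>R X) = (r\<^sup>2) *\<^sub>R (conj_transpose X ** X)"
    by (simp add: vec_eq_iff matrix_matrix_mult_def conj_transpose_def scaleR_sum_right power2_eq_square)
  then have "(conj_transpose (r *\<^sub>R X) ** (r *\<^sub>R X)) *v z
      = complex_of_real (r\<^sup>2) *s ((conj_transpose X ** X) *v z)" for z
    by (simp add: vec_eq_iff matrix_vector_mult_def sum_distrib_left)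
      (simp add: scaleR_conv_of_real mult.assoc)
  then have "singular_system (r *\<^sub>R X) b (\<lambda>j. \<bar>r\<bar> * s j)"
    using bs by (simp add: singular_system_def vector_smult_assoc power_mult_distrib)
  then have "schatten_pow p (r *\<^sub>R X) = \<bar>r\<bar> powr p * schatten_pow p X"
    using s by (simp add: schatten_pow_singular_system[of _ b] schatten_pow_singular_system[OF bs]
        powr_mult sum_distrib_left)
  then show ?thesis
    using p by (simp add: schatten_norm_eq powr_mult powr_powr schatten_pow_nonneg)
qed

section \<open>Two-point inequality for p < 2\<close>

text \<open>Let G have eigenbasis w and eigenvalues g. Then \<open>dom\<close> says X*X <= G, and
  the sum is Q = <b_i, G^-1 b_i>, with the pseudo-inverse because 1 / 0 = 0. Testing
  \<open>dom\<close> at z = G^-1 b_i and keeping only the i-th term on the left gives s_i^2 Q^2 <=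
  Q.\<close>

lemma sum_inverse_weights_le:
  fixes X :: "complex ^ 'n ^ 'n"
  assumes w: "onb w" and bs: "singular_system X b s" and g: "\<And>k. 0 \<le> g k"
    and dom: "\<And>z. (norm (X *v z))\<^sup>2 \<le> (\<Sum>k\<in>UNIV. (cmod (cip (w k) z))\<^sup>2 * g k)"
  shows "(s i)\<^sup>2 * (\<Sum>k\<in>UNIV. (cmod (cip (w k) (b i)))\<^sup>2 * (1 / g k)) \<le> 1"
proof -
  define Q where "Q = (\<Sum>k\<in>UNIV. (cmod (cip (w k) (b i)))\<^sup>2 * (1 / g k))"
  define z where "z = (\<Sum>k\<in>UNIV. (cip (w k) (b i) * complex_of_real (1 / g k)) *s w k)"
  have wz: "cip (w k) z = cip (w k) (b i) * complex_of_real (1 / g k)" for k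
  proof -
    have "cip (w k) z = (\<Sum>j\<in>UNIV. if j = k then cip (w k) (b i) * complex_of_real (1 / g k) else 0)"
      unfolding z_def cip_sum_right cip_scale_right using w
      by (intro sum.cong) (auto simp: onb_def)
    then show ?thesis by simp
  qed
  have Q0: "0 \<le> Q" unfolding Q_def using g by (intro sum_nonneg) auto
  have bz: "cip (b i) z = complex_of_real Q"
  proof -
    have "cip (b i) z = (\<Sum>k\<in>UNIV. cip (b i) (w k) * cip (w k) (b i) * complex_of_real (1 / g k))"
      by (simp add: onb_parseval_cip[OF w, of "b i" z] wz mult.assoc)
    also have "\<dots> = (\<Sum>k\<in>UNIV. complex_of_real ((cmod (cip (w k) (b i)))\<^sup>2 * (1 / g k)))"
      by (intro sum.cong refl) (metis cnj_cip complex_norm_square mult.commute of_real_mult)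
    finally show ?thesis by (simp add: Q_def)
  qed
  have "(s i)\<^sup>2 * Q\<^sup>2 = (cmod (cip (b i) z))\<^sup>2 * (s i)\<^sup>2"
    by (simp add: bz)
  also have "\<dots> \<le> (\<Sum>j\<in>UNIV. (cmod (cip (b j) z))\<^sup>2 * (s j)\<^sup>2)"
    by (rule member_le_sum) auto
  also have "\<dots> = (norm (X *v z))\<^sup>2"
    by (rule norm_mult_vec_singular_system[OF bs, symmetric])
  also have "\<dots> \<le> (\<Sum>k\<in>UNIV. (cmod (cip (w k) z))\<^sup>2 * g k)" by (rule dom)
  also have "\<dots> = Q"
    unfolding Q_def wz by (intro sum.cong refl)
      (simp add: norm_mult norm_divide power_mult_distrib power_divide power2_eq_square g)
  finally have *: "((s i)\<^sup>2 * Q) * Q \<le> Q" by (simp add: power2_eq_square mult.assoc)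
  have "(s i)\<^sup>2 * Q \<le> 1"
  proof (cases "Q = 0")
    case False
    then show ?thesis using * Q0 by simp
  qed simp
  then show ?thesis by (simp add: Q_def)
qed

text \<open>The replacement for operator monotonicity of the map t to t powr (p/2 - 1) in the
  subadditivity of the trace of a concave function.\<close>

lemma weighted_sum_le_schatten_pow:
  fixes X :: "complex ^ 'n ^ 'n"
  assumes w: "onb w" and g: "\<And>k. 0 \<le> g k" and p: "0 < p" "p < 2"
    and dom: "\<And>z. (norm (X *v z))\<^sup>2 \<le> (\<Sum>k\<in>UNIV. (cmod (cip (w k) z))\<^sup>2 * g k)"
  shows "(\<Sum>k\<in>UNIV. (norm (X *v w k))\<^sup>2 * g k powr (p / 2 - 1)) \<le> schatten_pow p X"
proof -
  obtain b s where bs: "singular_system X b s" using singular_system_exists by blast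
  then have b: "onb b" and s: "\<And>j. 0 \<le> s j" by (auto simp: singular_system_def)
  let ?d = "\<lambda>i k. (cmod (cip (w k) (b i)))\<^sup>2"
  have "(\<Sum>k\<in>UNIV. (norm (X *v w k))\<^sup>2 * g k powr (p / 2 - 1))
      = (\<Sum>k\<in>UNIV. \<Sum>i\<in>UNIV. (s i)\<^sup>2 * (?d i k * g k powr (p / 2 - 1)))"
    by (simp add: norm_mult_vec_singular_system[OF bs] sum_distrib_left sum_distrib_right
        cmod_cip_commute[of "b _"] mult.commute mult.left_commute)
  also have "\<dots> = (\<Sum>i\<in>UNIV. (s i)\<^sup>2 * (\<Sum>k\<in>UNIV. ?d i k * (1 / g k) powr (1 - p / 2)))"
  proof -
    have "g k powr (p / 2 - 1) = (1 / g k) powr (1 - p / 2)" for k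
      using g[of k] powr_minus_divide[of "g k" "1 - p / 2"] by (simp add: powr_divide)
    then show ?thesis by (subst sum.swap) (simp add: sum_distrib_left)
  qed
  also have "\<dots> \<le> (\<Sum>i\<in>UNIV. s i powr p)"
  proof (rule sum_mono)
    fix i
    let ?Q = "\<Sum>k\<in>UNIV. ?d i k * (1 / g k)"
    show "(s i)\<^sup>2 * (\<Sum>k\<in>UNIV. ?d i k * (1 / g k) powr (1 - p / 2)) \<le> s i powr p"
    proof (cases "s i = 0")
      case False
      then have si: "s i > 0" using s[of i] by simp
      \<comment> \<open>Since 0 < 1 - p/2 < 1, concave Jensen moves the power outside the sum, and
        \<open>sum_inverse_weights_le\<close> then bounds \<open>?Q\<close> by s_i^(-2).\<close>
      have "(\<Sum>k\<in>UNIV. ?d i k * (1 / g k) powr (1 - p / 2)) \<le> ?Q powr (1 - p / 2)"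
        using p g by (intro jensen_powr_concave) (auto simp: onb_parseval[OF w] onb_norm[OF b])
      also have "\<dots> \<le> (1 / (s i)\<^sup>2) powr (1 - p / 2)"
        using p g si sum_inverse_weights_le[OF w bs g dom, of i]
        by (intro powr_mono2) (auto intro!: sum_nonneg simp: field_simps)
      also have "\<dots> = s i powr (p - 2)"
      proof -
        have "1 / (s i)\<^sup>2 = s i powr (- 2)" using si by (simp add: powr_minus_divide)
        then show ?thesis by (simp add: powr_powr algebra_simps)
      qed
      finally have "(s i)\<^sup>2 * (\<Sum>k\<in>UNIV. ?d i k * (1 / g k) powr (1 - p / 2)) \<le> (s i)\<^sup>2 * s i powr (p - 2)"
        by (intro mult_left_mono) auto
      also have "\<dots> = s i powr p" using si by (simp add: powr_diff)
      finally show ?thesis .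
    qed simp
  qed
  finally show ?thesis by (simp add: schatten_pow_singular_system[OF bs])
qed

lemma norm_parallelogram: "(norm (a + b))\<^sup>2 + (norm (a - b))\<^sup>2 = 2 * ((norm a)\<^sup>2 + (norm b)\<^sup>2)"
  for a b :: "'a::real_inner"
  by (simp add: power2_norm_eq_inner inner_add_left inner_add_right inner_diff_left inner_diff_right)

lemma schatten_pow_two_point_le:
  fixes X Y :: "complex ^ 'n ^ 'n"
  assumes p: "0 < p" "p < 2"
  shows "schatten_pow p (X + Y) + schatten_pow p (X - Y) \<le> 2 * (schatten_pow p X + schatten_pow p Y)"
proof -
  let ?M = "conj_transpose X ** X + conj_transpose Y ** Y"
  have M: "conj_transpose ?M = ?M" by (simp add: conj_transpose_add hermitian_gram)
  obtain w g where w: "onb w" and eig: "\<And>k. ?M *v w k = complex_of_real (g k) *s w k"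
    using hermitian_spectral[OF M] by blast
  have q: "(norm (X *v z))\<^sup>2 + (norm (Y *v z))\<^sup>2 = (\<Sum>k\<in>UNIV. (cmod (cip (w k) z))\<^sup>2 * g k)" for z
  proof -
    have "complex_of_real ((norm (X *v z))\<^sup>2 + (norm (Y *v z))\<^sup>2) = cip z (?M *v z)"
      unfolding of_real_add norm_mult_vec_sq by (simp add: matrix_vector_mult_add_rdistrib cip_add_right)
    also note cip_quadratic_form_eigenbasis[OF M w eig]
    finally show ?thesis by (simp only: of_real_eq_iff)
  qed
  have gk: "g k = (norm (X *v w k))\<^sup>2 + (norm (Y *v w k))\<^sup>2" for k
  proof -
    have "(\<Sum>j\<in>UNIV. (cmod (cip (w j) (w k)))\<^sup>2 * g j) = (\<Sum>j\<in>UNIV. if j = k then g k else 0)"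
      using w by (intro sum.cong) (auto simp: onb_def)
    then show ?thesis unfolding q by simp
  qed
  have g0: "0 \<le> g k" for k by (simp add: gk)
  have "schatten_pow p (X + Y) + schatten_pow p (X - Y)
      \<le> (\<Sum>k\<in>UNIV. norm ((X + Y) *v w k) powr p) + (\<Sum>k\<in>UNIV. norm ((X - Y) *v w k) powr p)"
    using p by (intro add_mono schatten_pow_le_onb_sum w) auto
  also have "\<dots> = (\<Sum>k\<in>UNIV. norm ((X + Y) *v w k) powr p + norm ((X - Y) *v w k) powr p)"
    by (simp add: sum.distrib)
  also have "\<dots> \<le> (\<Sum>k\<in>UNIV. 2 * g k powr (p / 2))"
  proof (rule sum_mono)
    fix k
    let ?a = "norm ((X + Y) *v w k)" and ?b = "norm ((X - Y) *v w k)"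
    \<comment> \<open>The parallelogram law makes the mean of the two squares equal to the
      eigenvalue g_k, so concavity of t^(p/2) bounds both powers at once.\<close>
    have "(?a\<^sup>2 + ?b\<^sup>2) / 2 = g k"
      unfolding gk matrix_vector_mult_add_rdistrib matrix_vector_mult_diff_rdistrib norm_parallelogram
      by simp
    then have "((?a\<^sup>2) powr (p / 2) + (?b\<^sup>2) powr (p / 2)) / 2 \<le> g k powr (p / 2)"
      using powr_mean_ge[of "p / 2" "?a\<^sup>2" "?b\<^sup>2"] p by simp
    then show "?a powr p + ?b powr p \<le> 2 * g k powr (p / 2)"
      by (simp add: power2_powr_half)
  qed
  \<comment> \<open>One factor of g_k is split into its X and Y shares. As X*X and Y*Y are both
    dominated by X*X + Y*Y, \<open>weighted_sum_le_schatten_pow\<close> applies to each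
    share.\<close>
  also have "\<dots> = 2 * ((\<Sum>k\<in>UNIV. (norm (X *v w k))\<^sup>2 * g k powr (p / 2 - 1))
      + (\<Sum>k\<in>UNIV. (norm (Y *v w k))\<^sup>2 * g k powr (p / 2 - 1)))"
  proof -
    have "g k powr (p / 2) = g k * g k powr (p / 2 - 1)" for k
      using g0[of k] by (cases "g k = 0") (auto simp: powr_diff)
    then have "g k powr (p / 2) = (norm (X *v w k))\<^sup>2 * g k powr (p / 2 - 1)
        + (norm (Y *v w k))\<^sup>2 * g k powr (p / 2 - 1)" for k
      using gk[of k] by (metis distrib_right)
    then show ?thesis by (simp add: sum.distrib flip: sum_distrib_left)
  qed
  also have "\<dots> \<le> 2 * (schatten_pow p X + schatten_pow p Y)"
  proof -
    have "(norm (X *v z))\<^sup>2 \<le> (\<Sum>k\<in>UNIV. (cmod (cip (w k) z))\<^sup>2 * g k)"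
      "(norm (Y *v z))\<^sup>2 \<le> (\<Sum>k\<in>UNIV. (cmod (cip (w k) z))\<^sup>2 * g k)" for z
      by (simp_all flip: q)
    then show ?thesis
      using p g0 by (intro mult_left_mono add_mono weighted_sum_le_schatten_pow w) auto
  qed
  finally show ?thesis .
qed

section \<open>Two-point inequality for p \<ge> 2\<close>

definition psd :: "complex ^ 'n ^ 'n \<Rightarrow> bool" where
  "psd M \<longleftrightarrow> conj_transpose M = M \<and> (\<forall>z. 0 \<le> Re (cip z (M *v z)))"

lemma psd_gram: "psd (conj_transpose X ** X)"
  unfolding psd_def by (simp add: hermitian_gram flip: norm_mult_vec_sq)

lemma psd_add: "psd M \<Longrightarrow> psd N \<Longrightarrow> psd (M + N)"
  by (simp add: psd_def conj_transpose_add matrix_vector_mult_add_rdistrib cip_add_right)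

lemma psd_spectral:
  assumes "psd M"
  obtains u l where "onb u" "\<And>j. M *v u j = complex_of_real (l j) *s u j" "\<And>j. 0 \<le> l j"
proof -
  obtain u l where u: "onb u" and l: "\<And>j. M *v u j = complex_of_real (l j) *s u j"
    using assms hermitian_spectral unfolding psd_def by blast
  have "0 \<le> l j" for j
  proof -
    have "0 \<le> Re (cip (u j) (M *v u j))" using assms by (simp add: psd_def)
    then show ?thesis using u by (simp add: l cip_scale_right onb_def)
  qed
  then show ?thesis using that u l by blast
qed

section \<open>Second-order trace estimate on positive semidefinite matrices\<close>

lemma singular_system_hermitian:
  assumes "conj_transpose M = M" "onb u" "\<And>j. M *v u j = complex_of_real (l j) *s u j"
  shows "singular_system M u (\<lambda>j. \<bar>l j\<bar>)"
  unfolding singular_system_def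
  by (simp add: assms vector_scalar_commute vector_smult_assoc power2_eq_square
      flip: matrix_vector_mul_assoc)

text \<open>The tangent inequality gives the derivative at a; exchanging it for the derivative at b
  costs p (a^(p-1) - b^(p-1)) (a - b), which the tangent inequality at exponent p - 1 controls. The
  sum a^(p-2) + b^(p-2) covers both orders of a and b, and unlike a maximum it separates the
  variables.\<close>

lemma powr_quadratic_remainder_le:
  fixes a b p :: real
  assumes "2 \<le> p" "0 \<le> a" "0 \<le> b"
  shows "a powr p \<le> b powr p + p * b powr (p - 1) * (a - b)
    + p * (p - 1) * (a powr (p - 2) + b powr (p - 2)) * (a - b)\<^sup>2"
proof -
  have 1: "a powr p \<le> b powr p + p * a powr (p - 1) * (a - b)"
    using powr_tangent_le[of p a b] assms by (simp add: algebra_simps)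
  have "(a powr (p - 1) - b powr (p - 1)) * (a - b)
      \<le> (p - 1) * (a powr (p - 2) + b powr (p - 2)) * (a - b)\<^sup>2"
  proof (cases "b \<le> a")
    case True
    have "a powr (p - 1) - b powr (p - 1) \<le> (p - 1) * a powr (p - 2) * (a - b)"
      using powr_tangent_le[of "p - 1" a b] assms by (simp add: algebra_simps)
    also have "\<dots> \<le> (p - 1) * (a powr (p - 2) + b powr (p - 2)) * (a - b)"
      using assms True by (intro mult_right_mono mult_left_mono) auto
    finally show ?thesis using True by (simp add: mult_right_mono power2_eq_square flip: mult.assoc)
  next
    case False
    have "b powr (p - 1) - a powr (p - 1) \<le> (p - 1) * b powr (p - 2) * (b - a)"
      using powr_tangent_le[of "p - 1" b a] assms by (simp add: algebra_simps)
    also have "\<dots> \<le> (p - 1) * (a powr (p - 2) + b powr (p - 2)) * (b - a)"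
      using assms False by (intro mult_right_mono mult_left_mono) auto
    finally have "(b powr (p - 1) - a powr (p - 1)) * (b - a)
        \<le> (p - 1) * (a powr (p - 2) + b powr (p - 2)) * (b - a) * (b - a)"
      using False by (intro mult_right_mono) auto
    then show ?thesis by (simp add: power2_eq_square algebra_simps)
  qed
  then have "p * ((a powr (p - 1) - b powr (p - 1)) * (a - b))
      \<le> p * ((p - 1) * (a powr (p - 2) + b powr (p - 2)) * (a - b)\<^sup>2)"
    using assms by (intro mult_left_mono) auto
  with 1 show ?thesis by (simp add: algebra_simps)
qed

text \<open>Hoelder with exponents p/(p-2) and p/2; the second factor is bounded by
  \<open>bessel_sum_norm_powr_le\<close>.\<close>

lemma weighted_norms_holder:
  fixes Y :: "complex ^ 'n ^ 'n"
  assumes u: "onb u" and l: "\<And>i. 0 \<le> l i" and p: "2 < p"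
  shows "(\<Sum>i\<in>UNIV. l i powr (p - 2) * (norm (Y *v u i))\<^sup>2)
    \<le> (\<Sum>i\<in>UNIV. l i powr p) powr ((p - 2) / p) * (schatten_norm p Y)\<^sup>2"
proof -
  have "(\<Sum>i\<in>UNIV. l i powr (p - 2) * (norm (Y *v u i))\<^sup>2)
      \<le> (\<Sum>i\<in>UNIV. (l i powr (p - 2)) powr (p / (p - 2))) powr (1 / (p / (p - 2)))
        * (\<Sum>i\<in>UNIV. ((norm (Y *v u i))\<^sup>2) powr (p / 2)) powr (1 / (p / 2))"
    using p by (intro Holder_inequality_sum) (auto simp: field_simps)
  also have "\<dots> = (\<Sum>i\<in>UNIV. l i powr p) powr ((p - 2) / p)
        * (\<Sum>i\<in>UNIV. norm (Y *v u i) powr p) powr (2 / p)"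
    using p by (simp add: powr_powr power2_powr_half)
  also have "\<dots> \<le> (\<Sum>i\<in>UNIV. l i powr p) powr ((p - 2) / p) * schatten_pow p Y powr (2 / p)"
    using p by (intro mult_left_mono powr_mono2 bessel_sum_norm_powr_le onb_imp_bessel u)
      (auto intro!: sum_nonneg)
  also have "schatten_pow p Y powr (2 / p) = (schatten_norm p Y)\<^sup>2"
    using powr_powr[of "schatten_pow p Y" "1 / p" 2] by (simp add: schatten_norm_eq)
  finally show ?thesis .
qed

text \<open>A scalar inequality that is a sum of products of functions of a and of b, averaged against the
  weights given by the squared overlaps of the two eigenbases, becomes a trace inequality.\<close>

lemma schatten_pow_quadratic_remainder_le:
  fixes M N :: "complex ^ 'n ^ 'n"
  assumes M: "psd M" and N: "conj_transpose N = N" and v: "onb v" and b: "\<And>j. 0 \<le> b j"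
    and Nv: "\<And>j. N *v v j = complex_of_real (b j) *s v j" and p: "2 < p"
  shows "schatten_pow p M \<le> schatten_pow p N
    + p * (\<Sum>j\<in>UNIV. b j powr (p - 1) * Re (cip (v j) ((M - N) *v v j)))
    + p * (p - 1) * (schatten_norm p M powr (p - 2) + schatten_norm p N powr (p - 2))
        * (schatten_norm p (M - N))\<^sup>2"
proof -
  let ?Y = "M - N"
  obtain u a where u: "onb u" and Mu: "\<And>j. M *v u j = complex_of_real (a j) *s u j"
    and a: "\<And>j. 0 \<le> a j" using psd_spectral[OF M] by blast
  have MH: "conj_transpose M = M" using M by (simp add: psd_def)
  have YH: "conj_transpose ?Y = ?Y" using MH N by (simp add: conj_transpose_diff)
  have TM: "schatten_pow p M = (\<Sum>i\<in>UNIV. a i powr p)"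
    using schatten_pow_singular_system[OF singular_system_hermitian[OF MH u Mu]] a by simp
  have TN: "schatten_pow p N = (\<Sum>j\<in>UNIV. b j powr p)"
    using schatten_pow_singular_system[OF singular_system_hermitian[OF N v Nv]] b by simp
  define m where "m i j = (cmod (cip (u i) (v j)))\<^sup>2" for i j
  have m0: "0 \<le> m i j" for i j by (simp add: m_def)
  have mr: "(\<Sum>j\<in>UNIV. m i j) = 1" for i
    unfolding m_def cmod_cip_commute[of "u i"] by (simp add: onb_parseval[OF v] onb_norm[OF u])
  have mc: "(\<Sum>i\<in>UNIV. m i j) = 1" for j
    unfolding m_def by (simp add: onb_parseval[OF u] onb_norm[OF v])
  \<comment> \<open>In the mixed bases the entries of M - N are (a_i - b_j) <u_i, v_j>. So the
    scalar remainder becomes squared entries, and summing over one index leaves |(M - N) u_i|^2 or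
    |(M - N) v_j|^2.\<close>
  have mY: "m i j * (a i - b j)\<^sup>2 = (cmod (cip (u i) (?Y *v v j)))\<^sup>2" for i j
  proof -
    have "cip (u i) (?Y *v v j) = complex_of_real (a i - b j) * cip (u i) (v j)"
      by (simp add: matrix_vector_mult_diff_rdistrib cip_diff_right Nv cip_scale_right
          cip_mult_vec[of _ M] MH Mu cip_scale_left algebra_simps)
    then show ?thesis unfolding m_def by (simp add: norm_mult power_mult_distrib mult.commute del: of_real_diff)
  qed
  have Yu: "(\<Sum>j\<in>UNIV. (cmod (cip (u i) (?Y *v v j)))\<^sup>2) = (norm (?Y *v u i))\<^sup>2" for i
    unfolding cip_mult_vec YH unfolding cmod_cip_commute[of "?Y *v u i"] by (rule onb_parseval[OF v])
  have Yv: "(\<Sum>i\<in>UNIV. (cmod (cip (u i) (?Y *v v j)))\<^sup>2) = (norm (?Y *v v j))\<^sup>2" for j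
    by (rule onb_parseval[OF u])
  \<comment> \<open>With the base point N fixed, the first-order term is linear in M - N; this lets
    it cancel later between two opposite perturbations.\<close>
  have lin: "(\<Sum>i\<in>UNIV. m i j * (a i - b j)) = Re (cip (v j) (?Y *v v j))" for j
  proof -
    have "(\<Sum>i\<in>UNIV. m i j * (a i - b j)) = (\<Sum>i\<in>UNIV. m i j * a i) - b j"
      by (simp add: right_diff_distrib sum_subtractf mc flip: sum_distrib_right)
    moreover have "Re (cip (v j) (M *v v j)) = (\<Sum>i\<in>UNIV. m i j * a i)"
      by (simp add: cip_quadratic_form_eigenbasis[OF MH u Mu] m_def)
    moreover have "Re (cip (v j) (N *v v j)) = b j"
      using v by (simp add: Nv cip_scale_right onb_def)
    ultimately show ?thesis by (simp add: matrix_vector_mult_diff_rdistrib cip_diff_right)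
  qed
  have "schatten_pow p M = (\<Sum>i\<in>UNIV. \<Sum>j\<in>UNIV. m i j * a i powr p)"
    by (simp add: TM mr flip: sum_distrib_right)
  also have "\<dots> \<le> (\<Sum>i\<in>UNIV. \<Sum>j\<in>UNIV. m i j * (b j powr p + p * b j powr (p - 1) * (a i - b j)
      + p * (p - 1) * (a i powr (p - 2) + b j powr (p - 2)) * (a i - b j)\<^sup>2))"
    using p by (intro sum_mono mult_left_mono m0 powr_quadratic_remainder_le a b) auto
  also have "\<dots> = (\<Sum>i\<in>UNIV. \<Sum>j\<in>UNIV. m i j * b j powr p)
      + p * (\<Sum>i\<in>UNIV. \<Sum>j\<in>UNIV. b j powr (p - 1) * (m i j * (a i - b j)))
      + p * (p - 1) * ((\<Sum>i\<in>UNIV. \<Sum>j\<in>UNIV. a i powr (p - 2) * (m i j * (a i - b j)\<^sup>2))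
        + (\<Sum>i\<in>UNIV. \<Sum>j\<in>UNIV. b j powr (p - 2) * (m i j * (a i - b j)\<^sup>2)))"
    by (simp only: distrib_left distrib_right sum.distrib sum_distrib_left ac_simps)
  also have "(\<Sum>i\<in>UNIV. \<Sum>j\<in>UNIV. m i j * b j powr p) = schatten_pow p N"
    by (subst sum.swap) (simp add: TN mc flip: sum_distrib_right)
  also have "(\<Sum>i\<in>UNIV. \<Sum>j\<in>UNIV. b j powr (p - 1) * (m i j * (a i - b j)))
      = (\<Sum>j\<in>UNIV. b j powr (p - 1) * Re (cip (v j) (?Y *v v j)))"
    by (subst sum.swap) (simp add: lin flip: sum_distrib_left)
  also have "(\<Sum>i\<in>UNIV. \<Sum>j\<in>UNIV. a i powr (p - 2) * (m i j * (a i - b j)\<^sup>2))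
      = (\<Sum>i\<in>UNIV. a i powr (p - 2) * (norm (?Y *v u i))\<^sup>2)"
    by (simp add: mY Yu flip: sum_distrib_left)
  also have "(\<Sum>i\<in>UNIV. \<Sum>j\<in>UNIV. b j powr (p - 2) * (m i j * (a i - b j)\<^sup>2))
      = (\<Sum>j\<in>UNIV. b j powr (p - 2) * (norm (?Y *v v j))\<^sup>2)"
    by (subst sum.swap) (simp add: mY Yv flip: sum_distrib_left)
  also have "(\<Sum>i\<in>UNIV. a i powr (p - 2) * (norm (?Y *v u i))\<^sup>2)
        + (\<Sum>j\<in>UNIV. b j powr (p - 2) * (norm (?Y *v v j))\<^sup>2)
      \<le> schatten_norm p M powr (p - 2) * (schatten_norm p ?Y)\<^sup>2
        + schatten_norm p N powr (p - 2) * (schatten_norm p ?Y)\<^sup>2"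
    using weighted_norms_holder[where l = a and Y = ?Y, OF u a p]
      weighted_norms_holder[where l = b and Y = ?Y, OF v b p]
    by (simp add: schatten_norm_eq[of p M] schatten_norm_eq[of p N] TM TN powr_powr)
  finally show ?thesis
    using p by (simp add: mult_left_mono distrib_right mult.assoc)
qed

text \<open>Compare with U, the p-th power mean of u and v, which dominates their quadratic mean. If
  U <= a the claim is immediate; otherwise the bracket is at most 4 U^(p-2), and U^(p-2) cancels
  from both sides.\<close>

lemma two_point_from_powr:
  fixes a b u v p C :: real
  assumes p: "2 < p" and nn: "0 \<le> a" "0 \<le> b" "0 \<le> u" "0 \<le> v" and C: "0 \<le> C"
    and le: "u powr p + v powr p \<le> 2 * a powr p
      + C * (u powr (p - 2) + v powr (p - 2) + 2 * a powr (p - 2)) * b\<^sup>2"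
  shows "u\<^sup>2 + v\<^sup>2 \<le> 2 * a\<^sup>2 + 2 * (2 * C) * b\<^sup>2"
proof -
  define U where "U = ((u powr p + v powr p) / 2) powr (1 / p)"
  have U0: "0 \<le> U" by (simp add: U_def)
  have Up: "U powr p = (u powr p + v powr p) / 2"
    using p by (simp add: U_def powr_powr)
  have "((u\<^sup>2 + v\<^sup>2) / 2) powr (p / 2) \<le> ((u\<^sup>2) powr (p / 2) + (v\<^sup>2) powr (p / 2)) / 2"
    using p by (intro powr_mean_le) auto
  also have "\<dots> = (U\<^sup>2) powr (p / 2)"
    using nn U0 by (simp add: power2_powr_half Up)
  finally have UU: "(u\<^sup>2 + v\<^sup>2) / 2 \<le> U\<^sup>2"
    by (rule powr_le_powrD[rotated 2]) (use p in auto)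
  show ?thesis
  proof (cases "U \<le> a")
    case True
    then have "U\<^sup>2 \<le> a\<^sup>2" using U0 by (intro power_mono) auto
    moreover have "0 \<le> 2 * (2 * C) * b\<^sup>2" using C by simp
    ultimately show ?thesis using UU by simp
  next
    case False
    then have U: "0 < U" "a \<le> U" using nn by auto
    have mean: "(u powr (p - 2) + v powr (p - 2)) / 2 \<le> U powr (p - 2)"
    proof -
      have "((u powr p) powr ((p - 2) / p) + (v powr p) powr ((p - 2) / p)) / 2
          \<le> ((u powr p + v powr p) / 2) powr ((p - 2) / p)"
        using p by (intro powr_mean_ge) auto
      also have "\<dots> = U powr (p - 2)" using p by (simp add: U_def powr_powr)
      finally show ?thesis using p by (simp add: powr_powr)
    qed
    have aU: "a powr (p - 2) \<le> U powr (p - 2)" using U nn p by (intro powr_mono2) auto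
    have split: "x powr p = x powr (p - 2) * x\<^sup>2" if "0 \<le> x" for x
      using that by (cases "x = 0") (auto simp: powr_diff)
    have "2 * (U powr (p - 2) * U\<^sup>2) = u powr p + v powr p"
      using Up split[OF U0] by simp
    also note le
    also have "2 * a powr p + C * (u powr (p - 2) + v powr (p - 2) + 2 * a powr (p - 2)) * b\<^sup>2
        \<le> 2 * (U powr (p - 2) * a\<^sup>2) + C * (4 * U powr (p - 2)) * b\<^sup>2"
    proof (intro add_mono mult_left_mono mult_right_mono)
      show "a powr p \<le> U powr (p - 2) * a\<^sup>2"
        unfolding split[OF nn(1)] by (intro mult_right_mono aU) auto
    qed (use mean aU C in auto)
    finally have "U powr (p - 2) * U\<^sup>2 \<le> U powr (p - 2) * (a\<^sup>2 + 2 * C * b\<^sup>2)"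
      by (simp add: algebra_simps)
    then have "U\<^sup>2 \<le> a\<^sup>2 + 2 * C * b\<^sup>2" using U by simp
    then show ?thesis using UU by (simp add: algebra_simps)
  qed
qed

lemma schatten_norm_uminus: "0 < p \<Longrightarrow> schatten_norm p (- X) = schatten_norm p X"
  using schatten_norm_scaleR[of p "- 1" X] by simp

text \<open>The estimate is expanded at P in the directions Z and - Z with the same eigenbasis of P,
  so the linear terms p L cancel.\<close>

lemma schatten_two_point_psd:
  fixes P Z :: "complex ^ 'n ^ 'n"
  assumes p: "2 < p" and psd: "psd P" "psd (P + Z)" "psd (P - Z)"
  shows "(schatten_norm p (P + Z))\<^sup>2 + (schatten_norm p (P - Z))\<^sup>2
    \<le> 2 * (schatten_norm p P)\<^sup>2 + 2 * (2 * (p * (p - 1))) * (schatten_norm p Z)\<^sup>2"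
proof (rule two_point_from_powr[OF p])
  obtain v b where v: "onb v" and b: "\<And>j. 0 \<le> b j"
    and Pv: "\<And>j. P *v v j = complex_of_real (b j) *s v j"
    using psd_spectral[OF psd(1)] by metis
  have PH: "conj_transpose P = P" using psd(1) by (simp add: psd_def)
  define L where "L = (\<Sum>j\<in>UNIV. b j powr (p - 1) * Re (cip (v j) (Z *v v j)))"
  have neg: "cip z ((- Z) *v z) = - cip z (Z *v z)" for z
    using matrix_vector_mult_diff_rdistrib[of 0 Z z] by (simp add: cip_minus_right)
  have plus: "schatten_pow p (P + Z) \<le> schatten_pow p P + p * L
    + p * (p - 1) * (schatten_norm p (P + Z) powr (p - 2) + schatten_norm p P powr (p - 2))
        * (schatten_norm p Z)\<^sup>2"
    using schatten_pow_quadratic_remainder_le[OF psd(2) PH v b Pv p] by (simp add: L_def)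
  have minus: "schatten_pow p (P - Z) \<le> schatten_pow p P - p * L
    + p * (p - 1) * (schatten_norm p (P - Z) powr (p - 2) + schatten_norm p P powr (p - 2))
        * (schatten_norm p Z)\<^sup>2"
    using schatten_pow_quadratic_remainder_le[OF psd(3) PH v b Pv p] p
    by (simp add: L_def neg sum_negf schatten_norm_uminus)
  show "schatten_norm p (P + Z) powr p + schatten_norm p (P - Z) powr p \<le> 2 * schatten_norm p P powr p
      + p * (p - 1) * (schatten_norm p (P + Z) powr (p - 2) + schatten_norm p (P - Z) powr (p - 2)
        + 2 * schatten_norm p P powr (p - 2)) * (schatten_norm p Z)\<^sup>2"
    using plus minus p by (simp add: schatten_norm_powr algebra_simps)
qed (use p in \<open>auto simp: schatten_norm_nonneg\<close>)

section \<open>Doubling the exponent through Gram matrices\<close>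

lemma schatten_norm_gram:
  assumes "0 < r"
  shows "schatten_norm r (conj_transpose X ** X) = (schatten_norm (2 * r) X)\<^sup>2"
proof -
  obtain b s where bs: "singular_system X b s" using singular_system_exists by blast
  then have b: "onb b" and s: "\<And>j. 0 \<le> s j" by (auto simp: singular_system_def)
  have "singular_system (conj_transpose X ** X) b (\<lambda>j. \<bar>(s j)\<^sup>2\<bar>)"
    using bs by (intro singular_system_hermitian hermitian_gram b) (auto simp: singular_system_def)
  then have "schatten_pow r (conj_transpose X ** X) = (\<Sum>j\<in>UNIV. ((s j)\<^sup>2) powr (2 * r / 2))"
    by (simp add: schatten_pow_singular_system)
  also have "\<dots> = schatten_pow (2 * r) X"
    unfolding schatten_pow_singular_system[OF bs] power2_powr_half[OF s] ..
  finally show ?thesis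
    using powr_powr[of "schatten_pow (2 * r) X" "1 / (2 * r)" 2] by (simp add: schatten_norm_eq)
qed

text \<open>The cross term is Hermitian, with eigenvalues 2 Re <X v_j, Y v_j>. Cauchy-Schwarz for
  each j and Hoelder with exponents 2, 2 over j leave sums of |X v_j|^(2r) and |Y v_j|^(2r), where
  2r >= 2 permits the Bessel bound.\<close>

lemma schatten_norm_cross_term_le:
  fixes X Y :: "complex ^ 'n ^ 'n"
  assumes r: "1 \<le> r"
  shows "schatten_norm r (conj_transpose X ** Y + conj_transpose Y ** X)
    \<le> 2 * schatten_norm (2 * r) X * schatten_norm (2 * r) Y"
proof -
  let ?Z = "conj_transpose X ** Y + conj_transpose Y ** X"
  have Z: "conj_transpose ?Z = ?Z"
    by (simp add: conj_transpose_add conj_transpose_mult conj_transpose_conj_transpose add.commute)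
  obtain v l where v: "onb v" and l: "\<And>j. ?Z *v v j = complex_of_real (l j) *s v j"
    using hermitian_spectral[OF Z] by blast
  let ?x = "\<lambda>j. norm (X *v v j)" and ?y = "\<lambda>j. norm (Y *v v j)"
  have entry: "\<bar>l j\<bar> \<le> 2 * (?x j * ?y j)" for j
  proof -
    have "complex_of_real (l j) = cip (v j) (?Z *v v j)"
      using v by (simp add: l cip_scale_right onb_def)
    also have "\<dots> = cip (X *v v j) (Y *v v j) + cip (Y *v v j) (X *v v j)"
      by (simp add: matrix_vector_mult_add_rdistrib cip_add_right cip_mult_vec[of _ "conj_transpose _"]
          conj_transpose_conj_transpose flip: matrix_vector_mul_assoc)
    finally have "\<bar>l j\<bar> = cmod (cip (X *v v j) (Y *v v j) + cip (Y *v v j) (X *v v j))"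
      by (metis norm_of_real)
    also have "\<dots> \<le> cmod (cip (X *v v j) (Y *v v j)) + cmod (cip (Y *v v j) (X *v v j))"
      by (rule norm_triangle_ineq)
    also have "\<dots> \<le> ?x j * ?y j + ?y j * ?x j" by (intro add_mono cmod_cip_le)
    finally show ?thesis by simp
  qed
  have "schatten_pow r ?Z = (\<Sum>j\<in>UNIV. \<bar>l j\<bar> powr r)"
    by (rule schatten_pow_singular_system[OF singular_system_hermitian[OF Z v l]])
  also have "\<dots> \<le> (\<Sum>j\<in>UNIV. (2 * (?x j * ?y j)) powr r)"
    using r entry by (intro sum_mono powr_mono2) auto
  also have "\<dots> = 2 powr r * (\<Sum>j\<in>UNIV. ?x j powr r * ?y j powr r)"
    by (simp add: powr_mult sum_distrib_left)
  also have "(\<Sum>j\<in>UNIV. ?x j powr r * ?y j powr r)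
      \<le> (\<Sum>j\<in>UNIV. (?x j powr r) powr 2) powr (1/2) * (\<Sum>j\<in>UNIV. (?y j powr r) powr 2) powr (1/2)"
    by (intro Holder_inequality_sum) auto
  also have "\<dots> \<le> schatten_pow (2 * r) X powr (1/2) * schatten_pow (2 * r) Y powr (1/2)"
  proof -
    have "(\<Sum>j\<in>UNIV. (norm (W *v v j) powr r) powr 2) powr (1/2) \<le> schatten_pow (2 * r) W powr (1/2)"
      for W :: "complex ^ 'n ^ 'n"
      using bessel_sum_norm_powr_le[OF onb_imp_bessel[OF v], of "2 * r" W] r
      by (intro powr_mono2) (auto simp: powr_powr mult.commute sum_nonneg simp del: powr_numeral)
    then show ?thesis by (intro mult_mono) auto
  qed
  finally have "schatten_pow r ?Z \<le> 2 powr r * (schatten_pow (2 * r) X powr (1/2) * schatten_pow (2 * r) Y powr (1/2))"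
    by simp
  then have "schatten_norm r ?Z
      \<le> (2 powr r * (schatten_pow (2 * r) X powr (1/2) * schatten_pow (2 * r) Y powr (1/2))) powr (1 / r)"
    unfolding schatten_norm_eq using r by (intro powr_mono2) (auto simp: schatten_pow_nonneg)
  also have "\<dots> = 2 * schatten_norm (2 * r) X * schatten_norm (2 * r) Y"
    using r by (simp add: schatten_norm_eq powr_mult powr_powr)
  finally show ?thesis .
qed

text \<open>The squared Schatten 2r-norm of X is the r-norm of its Gram matrix, so a two-point inequality at
  r for the Gram matrices of X + Y and X - Y yields one at 2r. Starting from the parallelogram law,
  iteration gives the optimal constant p - 1 at powers of two.\<close>

lemma schatten_two_point_double:
  fixes X Y :: "complex ^ 'n ^ 'n"
  assumes r: "1 \<le> r" and K: "0 \<le> K"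
    and two: "\<And>P Z :: complex ^ 'n ^ 'n. psd P \<Longrightarrow> psd (P + Z) \<Longrightarrow> psd (P - Z) \<Longrightarrow>
      (schatten_norm r (P + Z))\<^sup>2 + (schatten_norm r (P - Z))\<^sup>2
        \<le> 2 * (schatten_norm r P)\<^sup>2 + 2 * K * (schatten_norm r Z)\<^sup>2"
  shows "(schatten_norm (2 * r) (X + Y))\<^sup>2 + (schatten_norm (2 * r) (X - Y))\<^sup>2
    \<le> 2 * (schatten_norm (2 * r) X)\<^sup>2 + 2 * (1 + 2 * K) * (schatten_norm (2 * r) Y)\<^sup>2"
proof -
  define P where "P = conj_transpose X ** X + conj_transpose Y ** Y"
  define Z where "Z = conj_transpose X ** Y + conj_transpose Y ** X"
  define a b where "a = schatten_norm (2 * r) X" and "b = schatten_norm (2 * r) Y"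
  have ab: "0 \<le> a" "0 \<le> b" by (auto simp: a_def b_def schatten_norm_nonneg)
  have PZ: "conj_transpose (X + Y) ** (X + Y) = P + Z"
    by (simp add: P_def Z_def vec_eq_iff matrix_matrix_mult_def conj_transpose_def
        algebra_simps sum.distrib)
  have PZ': "conj_transpose (X - Y) ** (X - Y) = P - Z"
    by (simp add: P_def Z_def vec_eq_iff matrix_matrix_mult_def conj_transpose_def
        algebra_simps sum.distrib sum_subtractf)
  define \<alpha> \<beta> where "\<alpha> = schatten_norm r (P + Z)" and "\<beta> = schatten_norm r (P - Z)"
  have ex: "(schatten_norm (2 * r) (X + Y))\<^sup>2 = \<alpha>" "(schatten_norm (2 * r) (X - Y))\<^sup>2 = \<beta>"
    using r by (simp_all add: \<alpha>_def \<beta>_def flip: PZ PZ' schatten_norm_gram)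
  have nP: "schatten_norm r P \<le> a\<^sup>2 + b\<^sup>2"
    using schatten_norm_triangle[OF r, of "conj_transpose X ** X" "conj_transpose Y ** Y"] r
    by (simp add: P_def a_def b_def schatten_norm_gram)
  have nZ: "schatten_norm r Z \<le> 2 * a * b"
    unfolding Z_def a_def b_def by (rule schatten_norm_cross_term_le[OF r])
  have "\<alpha>\<^sup>2 + \<beta>\<^sup>2 \<le> 2 * (schatten_norm r P)\<^sup>2 + 2 * K * (schatten_norm r Z)\<^sup>2"
    unfolding \<alpha>_def \<beta>_def
  proof (rule two)
    show "psd P" unfolding P_def by (intro psd_add psd_gram)
    show "psd (P + Z)" "psd (P - Z)" unfolding PZ[symmetric] PZ'[symmetric] by (rule psd_gram)+
  qed
  also have "\<dots> \<le> 2 * (a\<^sup>2 + b\<^sup>2)\<^sup>2 + 2 * K * (2 * a * b)\<^sup>2"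
    using nP nZ K by (intro add_mono mult_left_mono power_mono) (auto simp: schatten_norm_nonneg)
  \<comment> \<open>The coefficient 1 + 2 K is chosen so that the a^2 b^2 terms match exactly; what
    remains is a nonnegative multiple of b^4.\<close>
  also have "\<dots> \<le> 2 * (a\<^sup>2 + (1 + 2 * K) * b\<^sup>2)\<^sup>2"
  proof -
    have "(a\<^sup>2 + (1 + 2 * K) * b\<^sup>2)\<^sup>2 - ((a\<^sup>2 + b\<^sup>2)\<^sup>2 + K * (2 * a * b)\<^sup>2)
        = ((1 + 2 * K)\<^sup>2 - 1) * (b\<^sup>2)\<^sup>2"
      by (simp add: power2_eq_square algebra_simps)
    also have "\<dots> = (4 * K + 4 * K\<^sup>2) * (b\<^sup>2)\<^sup>2"
      by (simp add: power2_eq_square algebra_simps)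
    also have "\<dots> \<ge> 0" using K by simp
    finally show ?thesis by simp
  qed
  finally have "(\<alpha> + \<beta>)\<^sup>2 \<le> (2 * (a\<^sup>2 + (1 + 2 * K) * b\<^sup>2))\<^sup>2"
    using sum_squares_bound[of \<alpha> \<beta>] by (simp add: power2_sum power_mult_distrib)
  then have "\<alpha> + \<beta> \<le> 2 * (a\<^sup>2 + (1 + 2 * K) * b\<^sup>2)"
    by (rule power2_le_imp_le) (use K in auto)
  then show ?thesis unfolding ex by (simp add: a_def b_def algebra_simps)
qed

text \<open>At p = 2 the upper and the lower trace inequality both apply, so the squared norm is the
  sum of |W v_i|^2 in any orthonormal basis and the law holds vector by vector.\<close>

lemma schatten_parallelogram:
  fixes X Y :: "complex ^ 'n ^ 'n"
  shows "(schatten_norm 2 (X + Y))\<^sup>2 + (schatten_norm 2 (X - Y))\<^sup>2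
    = 2 * (schatten_norm 2 X)\<^sup>2 + 2 * (schatten_norm 2 Y)\<^sup>2"
proof -
  obtain v :: "'n \<Rightarrow> complex ^ 'n" where v: "onb v"
    using singular_system_exists[of X] by (auto simp: singular_system_def)
  have "(schatten_norm 2 W)\<^sup>2 = (\<Sum>i\<in>UNIV. (norm (W *v v i))\<^sup>2)" for W :: "complex ^ 'n ^ 'n"
  proof -
    have "(schatten_norm 2 W)\<^sup>2 = schatten_pow 2 W"
      using schatten_norm_powr[of 2 W] by (simp add: schatten_norm_nonneg)
    also have "\<dots> = (\<Sum>i\<in>UNIV. norm (W *v v i) powr 2)"
      using bessel_sum_norm_powr_le[OF onb_imp_bessel[OF v], of 2 W] schatten_pow_le_onb_sum[OF v, of 2 W]
      by simp
    finally show ?thesis by simp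
  qed
  then show ?thesis
    by (simp add: matrix_vector_mult_add_rdistrib matrix_vector_mult_diff_rdistrib norm_parallelogram
        sum_distrib_left distrib_left flip: sum.distrib)
qed

lemma schatten_two_point_ge_4:
  fixes X Y :: "complex ^ 'n ^ 'n"
  assumes "4 \<le> p"
  shows "(schatten_norm p (X + Y))\<^sup>2 + (schatten_norm p (X - Y))\<^sup>2
    \<le> 2 * (schatten_norm p X)\<^sup>2 + 2 * (7 * (p - 1)) * (schatten_norm p Y)\<^sup>2"
proof -
  \<comment> \<open>The real exponent p is halved repeatedly, so the induction runs over an n with p
    < 2^n.\<close>
  obtain n :: nat where "p < 2 ^ n" using real_arch_pow[of 2 p] by auto
  then show ?thesis using assms
  proof (induction n arbitrary: p X Y)
    case 0
    then show ?case by simp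
  next
    case (Suc n)
    define r where "r = p / 2"
    have pr: "p = 2 * r" and r2: "2 \<le> r" using Suc.prems by (auto simp: r_def)
    have weaken: "(schatten_norm p (X + Y))\<^sup>2 + (schatten_norm p (X - Y))\<^sup>2
        \<le> 2 * (schatten_norm p X)\<^sup>2 + 2 * (7 * (p - 1)) * (schatten_norm p Y)\<^sup>2"
      if K: "0 \<le> K" "1 + 2 * K \<le> 7 * (p - 1)"
        and two: "\<And>P Z :: complex ^ 'n ^ 'n. psd P \<Longrightarrow> psd (P + Z) \<Longrightarrow> psd (P - Z) \<Longrightarrow>
          (schatten_norm r (P + Z))\<^sup>2 + (schatten_norm r (P - Z))\<^sup>2
            \<le> 2 * (schatten_norm r P)\<^sup>2 + 2 * K * (schatten_norm r Z)\<^sup>2" for K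
    proof -
      have "(schatten_norm p (X + Y))\<^sup>2 + (schatten_norm p (X - Y))\<^sup>2
          \<le> 2 * (schatten_norm p X)\<^sup>2 + 2 * (1 + 2 * K) * (schatten_norm p Y)\<^sup>2"
        unfolding pr using r2 by (intro schatten_two_point_double K two) auto
      also have "\<dots> \<le> 2 * (schatten_norm p X)\<^sup>2 + 2 * (7 * (p - 1)) * (schatten_norm p Y)\<^sup>2"
        using K by (intro add_mono mult_right_mono) auto
      finally show ?thesis .
    qed
    consider "r = 2" | "2 < r" "r < 4" | "4 \<le> r" using r2 by linarith
    then show ?case
    proof cases
      case 1
      show ?thesis
        by (rule weaken[of 1]) (use 1 pr in \<open>auto simp: schatten_parallelogram\<close>)
    next
      case 2
      \<comment> \<open>The source of the constant 7: doubling K = 2 r (r - 1) gives exactly (p -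
        1)^2, and p = 2 r < 8 bounds one factor by 7.\<close>
      have "1 + 2 * (2 * (r * (r - 1))) = (p - 1) * (p - 1)" by (simp add: pr algebra_simps)
      also have "\<dots> \<le> 7 * (p - 1)" using 2 by (intro mult_right_mono) (auto simp: pr)
      finally show ?thesis
        using 2 schatten_two_point_psd[of r] by (intro weaken[of "2 * (r * (r - 1))"]) auto
    next
      case 3
      \<comment> \<open>The bound 7 (p - 1) survives further doublings, since 1 + 2 * 7 (r - 1) = 7
        p - 13.\<close>
      have "r < 2 ^ n" using Suc.prems by (simp add: r_def)
      then show ?thesis
        using 3 Suc.IH[of r] by (intro weaken[of "7 * (r - 1)"]) (auto simp: pr)
    qed
  qed
qed

section \<open>Approximate Caratheodory theorem\<close>

lemma convex_on_schatten_norm_powr: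
  assumes p: "1 \<le> p" and q: "1 \<le> q"
  shows "convex_on UNIV (\<lambda>X :: complex ^ 'n ^ 'n. schatten_norm p X powr q)"
proof (rule convex_onI)
  fix t :: real and X Y :: "complex ^ 'n ^ 'n"
  assume t: "0 < t" "t < 1"
  have "schatten_norm p ((1 - t) *\<^sub>R X + t *\<^sub>R Y) \<le> (1 - t) * schatten_norm p X + t * schatten_norm p Y"
    using schatten_norm_triangle[OF p, of "(1 - t) *\<^sub>R X" "t *\<^sub>R Y"] t p
    by (simp add: schatten_norm_scaleR)
  then have "schatten_norm p ((1 - t) *\<^sub>R X + t *\<^sub>R Y) powr q
      \<le> ((1 - t) * schatten_norm p X + t * schatten_norm p Y) powr q"
    using q by (intro powr_mono2) (auto simp: schatten_norm_nonneg)
  also have "\<dots> \<le> (1 - t) * schatten_norm p X powr q + t * schatten_norm p Y powr q"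
    using jensen_powr[of q "{True, False}" "\<lambda>c. if c then 1 - t else t"
        "\<lambda>c. if c then schatten_norm p X else schatten_norm p Y"] t q
    by (auto simp: schatten_norm_nonneg)
  finally show "schatten_norm p ((1 - t) *\<^sub>R X + t *\<^sub>R Y) powr q
      \<le> (1 - t) * schatten_norm p X powr q + t * schatten_norm p Y powr q" .
qed auto

text \<open>Both ranges of p are instances: q = p with K = 1, and q = 2 with K = 7 (p - 1). The
  condition \<open>kD\<close> is the greedy bound k K D^q <= (k eps)^q, divided by k eps^q.\<close>

lemma schatten_approximate_caratheodory:
  fixes S :: "(complex ^ 'n ^ 'n) set"
  assumes p: "1 \<le> p" and q: "1 \<le> q" and k: "0 < k" and K: "0 \<le> K"
    and two: "\<And>X Y :: complex ^ 'n ^ 'n. schatten_norm p (X + Y) powr q + schatten_norm p (X - Y) powr q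
      \<le> 2 * schatten_norm p X powr q + 2 * K * schatten_norm p Y powr q"
    and diam: "\<And>X Y. X \<in> S \<Longrightarrow> Y \<in> S \<Longrightarrow> schatten_norm p (X - Y) \<le> D"
    and A: "A \<in> convex hull S" and e: "0 < \<epsilon>"
    and kD: "K * (D / \<epsilon>) powr q \<le> real k powr (q - 1)"
  shows "\<exists>X. (\<forall>i<k. X i \<in> S) \<and> schatten_norm p (A - (1 / real k) *\<^sub>R (\<Sum>i<k. X i)) \<le> \<epsilon>"
proof -
  let ?f = "\<lambda>X :: complex ^ 'n ^ 'n. schatten_norm p X powr q"
  have zero: "schatten_norm p (0 :: complex ^ 'n ^ 'n) = 0"
    using schatten_norm_scaleR[of p 0 "0 :: complex ^ 'n ^ 'n"] p by simp
  have D0: "0 \<le> D"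
  proof -
    have "S \<noteq> {}" using A by auto
    then show ?thesis using diam schatten_norm_nonneg order_trans by blast
  qed
  have "\<exists>X. (\<forall>i<k. X i \<in> S) \<and> ?f (\<Sum>i<k. X i - A) \<le> real k * (K * D powr q)"
  proof (rule maurey_greedy[OF convex_on_schatten_norm_powr[OF p q] _ _ A])
    fix X a b assume "a \<in> S" "b \<in> S"
    then have "?f (a - b) \<le> D powr q"
      using diam q by (intro powr_mono2) (auto simp: schatten_norm_nonneg)
    from mult_left_mono[OF this K]
    show "?f (X + (a - b)) + ?f (X - (a - b)) \<le> 2 * ?f X + 2 * (K * D powr q)"
      using two[of X "a - b"] by simp
  qed (simp add: zero)
  then obtain X where X: "\<forall>i<k. X i \<in> S" and le: "?f (\<Sum>i<k. X i - A) \<le> real k * (K * D powr q)"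
    by blast
  have "A - (1 / real k) *\<^sub>R (\<Sum>i<k. X i) = (- 1 / real k) *\<^sub>R (\<Sum>i<k. X i - A)"
    using k by (simp add: sum_subtractf scaleR_diff_right sum_constant_scaleR del: sum_constant)
  then have "schatten_norm p (A - (1 / real k) *\<^sub>R (\<Sum>i<k. X i)) = schatten_norm p (\<Sum>i<k. X i - A) / real k"
    using p by (simp only: schatten_norm_scaleR) simp
  also have "\<dots> \<le> \<epsilon>"
  proof -
    have "real k * (K * D powr q) = real k * (K * (D / \<epsilon>) powr q) * \<epsilon> powr q"
      using e D0 by (simp add: powr_divide)
    also have "\<dots> \<le> real k * real k powr (q - 1) * \<epsilon> powr q"
      using kD by (intro mult_left_mono mult_right_mono) auto
    also have "\<dots> = (real k * \<epsilon>) powr q"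
      using k e by (simp add: powr_mult powr_diff)
    finally have "?f (\<Sum>i<k. X i - A) \<le> (real k * \<epsilon>) powr q" using le by simp
    then have "schatten_norm p (\<Sum>i<k. X i - A) \<le> real k * \<epsilon>"
      by (rule powr_le_powrD[rotated 2]) (use q e in auto)
    then show ?thesis using k by (simp add: field_simps)
  qed
  finally show ?thesis using X by blast
qed

text \<open>Boundedness makes the real supremum in \<open>schatten_diam\<close> a genuine upper
  bound; for an unbounded set its value would be unspecified.\<close>

lemma schatten_norm_diff_le_diam:
  assumes p: "1 \<le> p" and S: "schatten_bounded p S" and XY: "X \<in> S" "Y \<in> S"
  shows "schatten_norm p (X - Y) \<le> schatten_diam p S"
proof -
  obtain M where M: "\<And>X. X \<in> S \<Longrightarrow> schatten_norm p X \<le> M" using S by (auto simp: schatten_bounded_def)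
  have "schatten_norm p (X - Y) \<le> M + M" if "X \<in> S" "Y \<in> S" for X Y
    using schatten_norm_triangle[OF p, of X "- Y"] schatten_norm_uminus[of p Y] p M[OF that(1)] M[OF that(2)]
    by simp
  then have "bdd_above ((\<lambda>XY. schatten_norm p (fst XY - snd XY)) ` (S \<times> S))"
    by (intro bdd_aboveI2[where M = "M + M"]) auto
  from cSUP_upper[OF _ this, of "(X, Y)"] show ?thesis
    using XY by (simp add: schatten_diam_def)
qed

text \<open>The \<open>max 1\<close> takes effect exactly when the diameter is 0: the ceiling is
  then 0, while an average needs at least one point.\<close>

theorem mainTheorem3:
  fixes S :: "(complex ^ 'n ^ 'n) set" and A :: "complex ^ 'n ^ 'n"
    and p \<epsilon> :: real and k :: nat
  assumes "schatten_bounded p S"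
    and "A \<in> convex hull S"
    and "\<epsilon> > 0"
    and "(1 < p \<and> p \<le> 4/3 \<and>
           k = max 1 (nat \<lceil>(2 * exp 2 / p powr (1/p)) powr (p/(p-1))
                          * (schatten_diam p S / \<epsilon>) powr (p/(p-1))\<rceil>))
       \<or> ((p = 2 \<or> 4 \<le> p) \<and>
           k = max 1 (nat \<lceil>2 * (p - 1) * exp 4 * (schatten_diam p S / \<epsilon>)^2\<rceil>))"
  shows "\<exists>X :: nat \<Rightarrow> complex ^ 'n ^ 'n.
           (\<forall>i<k. X i \<in> S) \<and>
           schatten_norm p (A - (1 / real k) *\<^sub>R (\<Sum>i<k. X i)) \<le> \<epsilon>"
proof -
  let ?D = "schatten_diam p S"
  have p1: "1 \<le> p" and k0: "0 < k" using assms(4) by auto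
  have D: "\<And>X Y. X \<in> S \<Longrightarrow> Y \<in> S \<Longrightarrow> schatten_norm p (X - Y) \<le> ?D"
    by (rule schatten_norm_diff_le_diam[OF p1 assms(1)])
  have D0: "0 \<le> ?D"
  proof -
    have "S \<noteq> {}" using assms(2) by auto
    then show ?thesis using D schatten_norm_nonneg order_trans by blast
  qed
  from assms(4) show ?thesis
  proof (elim disjE[of "_ \<and> _ \<and> _" "_ \<and> _"])
    assume a: "1 < p \<and> p \<le> 4/3 \<and>
           k = max 1 (nat \<lceil>(2 * exp 2 / p powr (1/p)) powr (p/(p-1)) * (?D / \<epsilon>) powr (p/(p-1))\<rceil>)"
    \<comment> \<open>The two-point inequality has K = 1 here, so C_p only has to be at least 1:
      p^(1/p) <= p <= 4/3, while exp 2 >= 3.\<close>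
    have C: "1 \<le> (2 * exp 2 / p powr (1/p)) powr (p/(p-1))"
    proof (rule ge_one_powr_ge_zero)
      have "p powr (1/p) \<le> p powr 1" using a by (intro powr_mono) auto
      also have "\<dots> \<le> 2 * exp 2" using a exp_ge_add_one_self[of "2 :: real"] by simp
      finally show "1 \<le> 2 * exp 2 / p powr (1/p)" using a by simp
    qed (use a in auto)
    have "(?D / \<epsilon>) powr (p/(p-1)) \<le> (2 * exp 2 / p powr (1/p)) powr (p/(p-1)) * (?D / \<epsilon>) powr (p/(p-1))"
      using mult_right_mono[OF C, of "(?D / \<epsilon>) powr (p/(p-1))"] by simp
    also have "\<dots> \<le> real k" using a by linarith
    finally have "((?D / \<epsilon>) powr (p/(p-1))) powr (p - 1) \<le> real k powr (p - 1)"
      using a by (intro powr_mono2) auto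
    then have kD: "1 * (?D / \<epsilon>) powr p \<le> real k powr (p - 1)"
      using a by (simp add: powr_powr)
    show ?thesis
    proof (rule schatten_approximate_caratheodory[OF p1 p1 k0 _ _ D assms(2,3) kD])
      fix X Y :: "complex ^ 'n ^ 'n"
      show "schatten_norm p (X + Y) powr p + schatten_norm p (X - Y) powr p
          \<le> 2 * schatten_norm p X powr p + 2 * 1 * schatten_norm p Y powr p"
        using schatten_pow_two_point_le[of p X Y] a by (simp add: schatten_norm_powr)
    qed auto
  next
    assume b: "(p = 2 \<or> 4 \<le> p) \<and> k = max 1 (nat \<lceil>2 * (p - 1) * exp 4 * (?D / \<epsilon>)^2\<rceil>)"
    \<comment> \<open>From exp 4 >= 5 follows 2 exp 4 >= 10, so D_p dominates the constant 7 (p -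
      1).\<close>
    have "(p - 1) * 7 \<le> (p - 1) * (2 * exp 4)"
      using p1 exp_ge_add_one_self[of "4 :: real"] by (intro mult_left_mono) auto
    then have "7 * (p - 1) * (?D / \<epsilon>)^2 \<le> 2 * (p - 1) * exp 4 * (?D / \<epsilon>)^2"
      by (intro mult_right_mono) (simp_all only: mult.assoc mult.commute mult.left_commute zero_le_power2)
    also have "\<dots> \<le> real k" using b by linarith
    finally have kD: "7 * (p - 1) * (?D / \<epsilon>) powr 2 \<le> real k powr (2 - 1)"
      using k0 D0 assms(3) by simp
    have two: "(schatten_norm p (X + Y))\<^sup>2 + (schatten_norm p (X - Y))\<^sup>2
        \<le> 2 * (schatten_norm p X)\<^sup>2 + 2 * (7 * (p - 1)) * (schatten_norm p Y)\<^sup>2"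
      for X Y :: "complex ^ 'n ^ 'n"
    proof (cases "p = 2")
      case True
      then show ?thesis using schatten_parallelogram[of X Y] by simp
    next
      case False
      then show ?thesis using b schatten_two_point_ge_4 by blast
    qed
    show ?thesis
    proof (rule schatten_approximate_caratheodory[OF p1 _ k0 _ _ D assms(2,3) kD])
      fix X Y :: "complex ^ 'n ^ 'n"
      show "schatten_norm p (X + Y) powr 2 + schatten_norm p (X - Y) powr 2
          \<le> 2 * schatten_norm p X powr 2 + 2 * (7 * (p - 1)) * schatten_norm p Y powr 2"
        using two by (simp add: schatten_norm_nonneg)
    qed (use p1 in auto)
  qed
qed

end
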